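(* Let $K$ be a polygonal knot and let $0<r<R(K)$. Then $Tube(K,r)$ is an embedded torus.
   Context: A polygonal knot $K$ with $n$ edges is given by distinct vertices $v_1,\dots,v_n\in\mathbb{R}^3$ (indices mod $n$), with edges $e_i=[v_i,v_{i+1}]$ meeting only at the common vertex of adjacent edges. $Tube(e_i,r)$ is the union of the closed balls of radius $r$ centered at the points of $e_i$, and $Tube(K,r)=\bigcup_i Tube(e_i,r)$ (here "embedded torus" means an embedded solid torus with $K$ as its core). $angle(v_i)\in[0,\pi)$ is the turning angle at $v_i$ (angle between $v_i-v_{i-1}$ and $v_{i+1}-v_i$); $Rad(v_i)=\dfrac{\min\{|e_{i-1}|,|e_i|\}}{2\tan(angle(v_i)/2)}$, $MinRad(K)=\min_i Rad(v_i)$. For $x\in K$, $d_x(y)=\Vert x-y\Vert$; $y$ is a turning point for $x$ if moving along the knot $d_x$ changes from increasing to decreasing or vice versa at $y$. $DC(K)$ is the set of pairs $(x,y)$, $x\neq y$, with $x$ a turning point of $d_y$ and $y$ a turning point of $d_x$; $dcsd(K)=\min\{\Vert x-y\Vert:(x,y)\in DC(K)\}$; the polygonal thickness radius is $R(K)=\min\{MinRad(K),dcsd(K)/2\}$. *)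

theory Defs
  imports "HOL-Analysis.Analysis" "HOL-Library.Extended_Real"
begin

type_synonym pt = "real^3"

text \<open>A polygon with n vertices v 0, ..., v (n-1); indices are taken mod n.\<close>

definition vtx :: "(nat \<Rightarrow> pt) \<Rightarrow> nat \<Rightarrow> nat \<Rightarrow> pt" where
  "vtx v n i = v (i mod n)"

definition edge :: "(nat \<Rightarrow> pt) \<Rightarrow> nat \<Rightarrow> nat \<Rightarrow> pt set" where
  "edge v n i = closed_segment (vtx v n i) (vtx v n (Suc i))"

definition polygonal_knot :: "(nat \<Rightarrow> pt) \<Rightarrow> nat \<Rightarrow> bool" where
  "polygonal_knot v n \<longleftrightarrow> 3 \<le> n \<and> inj_on v {..<n} \<and>
     (\<forall>i<n. \<forall>j<n. i \<noteq> j \<longrightarrow>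
        edge v n i \<inter> edge v n j =
          (if j = Suc i mod n then {vtx v n (Suc i)}
           else if i = Suc j mod n then {vtx v n (Suc j)}
           else {}))"

definition knot_set :: "(nat \<Rightarrow> pt) \<Rightarrow> nat \<Rightarrow> pt set" where
  "knot_set v n = (\<Union>i<n. edge v n i)"

definition Tube_edge :: "(nat \<Rightarrow> pt) \<Rightarrow> nat \<Rightarrow> nat \<Rightarrow> real \<Rightarrow> pt set" where
  "Tube_edge v n i r = (\<Union>x\<in>edge v n i. cball x r)"

definition Tube :: "(nat \<Rightarrow> pt) \<Rightarrow> nat \<Rightarrow> real \<Rightarrow> pt set" where
  "Tube v n r = (\<Union>i<n. Tube_edge v n i r)"

definition turning_angle :: "(nat \<Rightarrow> pt) \<Rightarrow> nat \<Rightarrow> nat \<Rightarrow> real" where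
  "turning_angle v n i =
     (let a = vtx v n i - vtx v n (i + n - 1); b = vtx v n (Suc i) - vtx v n i
      in arccos ((a \<bullet> b) / (norm a * norm b)))"

definition edge_len :: "(nat \<Rightarrow> pt) \<Rightarrow> nat \<Rightarrow> nat \<Rightarrow> real" where
  "edge_len v n i = dist (vtx v n i) (vtx v n (Suc i))"

definition Rad :: "(nat \<Rightarrow> pt) \<Rightarrow> nat \<Rightarrow> nat \<Rightarrow> ereal" where
  "Rad v n i =
     (if turning_angle v n i = 0 then \<infinity>
      else ereal (min (edge_len v n (i + n - 1)) (edge_len v n i)
                  / (2 * tan (turning_angle v n i / 2))))"

definition MinRad :: "(nat \<Rightarrow> pt) \<Rightarrow> nat \<Rightarrow> ereal" where
  "MinRad v n = Min (Rad v n ` {..<n})"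

definition knot_path :: "(nat \<Rightarrow> pt) \<Rightarrow> nat \<Rightarrow> real \<Rightarrow> pt" where
  "knot_path v n t =
     (let k = nat (\<lfloor>t\<rfloor> mod int n); s = t - of_int \<lfloor>t\<rfloor>
      in (1 - s) *\<^sub>R vtx v n k + s *\<^sub>R vtx v n (Suc k))"

definition turning_point :: "(nat \<Rightarrow> pt) \<Rightarrow> nat \<Rightarrow> pt \<Rightarrow> pt \<Rightarrow> bool" where
  "turning_point v n x y \<longleftrightarrow>
     (\<exists>t. knot_path v n t = y \<and>
        (let f = (\<lambda>s. dist x (knot_path v n s)) in
         \<exists>e>0.
          ((\<forall>s1 s2. t - e \<le> s1 \<and> s1 < s2 \<and> s2 \<le> t \<longrightarrow> f s1 < f s2) \<and>
           (\<forall>s1 s2. t \<le> s1 \<and> s1 < s2 \<and> s2 \<le> t + e \<longrightarrow> f s1 > f s2)) \<or>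
          ((\<forall>s1 s2. t - e \<le> s1 \<and> s1 < s2 \<and> s2 \<le> t \<longrightarrow> f s1 > f s2) \<and>
           (\<forall>s1 s2. t \<le> s1 \<and> s1 < s2 \<and> s2 \<le> t + e \<longrightarrow> f s1 < f s2))))"

definition DC :: "(nat \<Rightarrow> pt) \<Rightarrow> nat \<Rightarrow> (pt \<times> pt) set" where
  "DC v n = {(x, y). x \<in> knot_set v n \<and> y \<in> knot_set v n \<and> x \<noteq> y \<and>
                     turning_point v n y x \<and> turning_point v n x y}"

definition dcsd :: "(nat \<Rightarrow> pt) \<Rightarrow> nat \<Rightarrow> ereal" where
  "dcsd v n = Inf ((\<lambda>(x, y). ereal (dist x y)) ` DC v n)"

definition thickness_radius :: "(nat \<Rightarrow> pt) \<Rightarrow> nat \<Rightarrow> ereal" where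
  "thickness_radius v n = min (MinRad v n) (dcsd v n / 2)"

definition embedded_solid_torus_with_core :: "pt set \<Rightarrow> pt set \<Rightarrow> bool" where
  "embedded_solid_torus_with_core T C \<longleftrightarrow>
     (\<exists>h g. homeomorphism (sphere (0::complex) 1 \<times> cball (0::complex) 1) T h g \<and>
            h ` (sphere 0 1 \<times> {0}) = C)"

end

theory Submission
  imports Defs
begin

text \<open>
  The planes bisecting the angles at the vertices cut the tube into convex cells, one for each edge:
  the points within distance \<open>r\<close> of the edge that lie between the two bisecting planes at its ends.
  As \<open>r\<close> is smaller than \<open>MinRad\<close>, these two planes do not meet within the tube of the edge, and
  reflection in a bisecting plane maps the relevant part of one edge into the adjacent edge. Hence every
  point of the tube lies in the cell of an edge nearest to it, and adjacent cells meet exactly in a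
  disc of the bisecting plane.

  Non-adjacent cells are disjoint: otherwise choose a point \<open>p\<close> in two of them that minimises the larger
  of its distances to the two edges. If \<open>p\<close> were not the midpoint of its feet \<open>x\<close> and \<open>y\<close> on the
  edges, moving it towards the midpoint would decrease both distances; a point that leaves its cell
  during this motion enters a neighbouring cell and only comes closer to the polygon. So \<open>p\<close> is
  the midpoint, and \<open>(x, y)\<close> is a doubly critical pair at distance at most \<open>2 r\<close>.

  Every cell is sliced by planes whose normals interpolate linearly between the normals of the bisecting
  planes. In such a slice the distance to the edge increases strictly along the rays from the core
  point, so it serves as the radial coordinate of a disc. A vector outside the finitely many planes
  swept out by the normals frames all slices simultaneously, which trivialises the disc bundle.
\<close>

section \<open>Reflection at a corner\<close>

lemma dist_ray_sq:
  fixes q v u :: "'a::real_inner"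
  shows "(dist q (v + s *\<^sub>R u))\<^sup>2 = (dist q v)\<^sup>2 - 2 * s * ((q - v) \<bullet> u) + s\<^sup>2 * (u \<bullet> u)"
proof -
  have "q - (v + s *\<^sub>R u) = (q - v) - s *\<^sub>R u" by simp
  moreover have "(w - s *\<^sub>R u) \<bullet> (w - s *\<^sub>R u) = w \<bullet> w - 2 * s * (w \<bullet> u) + s\<^sup>2 * (u \<bullet> u)" for w
    by (simp add: inner_diff_left inner_diff_right inner_commute algebra_simps power2_eq_square)
  ultimately show ?thesis unfolding dist_norm power2_norm_eq_inner by presburger
qed

text \<open>Moving the foot by \<open>\<tau>\<close> along the segment changes the squared distance
  by \<open>\<tau>\<^sup>2 - 2 * \<tau> * b\<close>, which is negative for small
  \<open>\<tau>\<close> of the same sign as \<open>b\<close>. Each condition needs room on one side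
  only.\<close>

lemma foot_on_ray:
  fixes p v u :: "'a::real_inner"
  assumes u: "norm u = 1" and s: "0 \<le> s" "s \<le> l"
    and near: "\<And>\<sigma>. 0 \<le> \<sigma> \<Longrightarrow> \<sigma> \<le> l \<Longrightarrow> dist p (v + s *\<^sub>R u) \<le> dist p (v + \<sigma> *\<^sub>R u)"
  shows "0 < s \<Longrightarrow> (p - (v + s *\<^sub>R u)) \<bullet> u \<ge> 0"
    and "s < l \<Longrightarrow> (p - (v + s *\<^sub>R u)) \<bullet> u \<le> 0"
proof -
  define b where "b = (p - (v + s *\<^sub>R u)) \<bullet> u"
  have step: "\<tau>\<^sup>2 - 2 * \<tau> * b \<ge> 0" if "0 \<le> s + \<tau>" "s + \<tau> \<le> l" for \<tau>
  proof -
    have "(dist p (v + s *\<^sub>R u))\<^sup>2 \<le> (dist p (v + (s + \<tau>) *\<^sub>R u))\<^sup>2"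
      using near[OF that] by (simp add: power_mono)
    also have "v + (s + \<tau>) *\<^sub>R u = (v + s *\<^sub>R u) + \<tau> *\<^sub>R u"
      by (simp add: algebra_simps)
    also have "(dist p ((v + s *\<^sub>R u) + \<tau> *\<^sub>R u))\<^sup>2 = (dist p (v + s *\<^sub>R u))\<^sup>2 - 2 * \<tau> * b + \<tau>\<^sup>2"
      using u by (simp add: dist_ray_sq[of p "v + s *\<^sub>R u"] b_def norm_eq_1)
    finally show ?thesis by simp
  qed
  show "b \<ge> 0" if "0 < s"
  proof (rule ccontr)
    assume "\<not> b \<ge> 0"
    define \<tau> where "\<tau> = min s (- b)"
    have "\<tau> > 0" "\<tau> \<le> - b" "\<tau> \<le> s" using that \<open>\<not> b \<ge> 0\<close> by (auto simp: \<tau>_def)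
    then have "\<tau> * (\<tau> + 2 * b) < 0" by (simp add: mult_pos_neg)
    moreover have "(-\<tau>)\<^sup>2 - 2 * (-\<tau>) * b \<ge> 0"
      using \<open>\<tau> > 0\<close> \<open>\<tau> \<le> s\<close> s by (intro step) auto
    ultimately show False by (simp add: power2_eq_square algebra_simps)
  qed
  show "b \<le> 0" if "s < l"
  proof (rule ccontr)
    assume "\<not> b \<le> 0"
    define \<tau> where "\<tau> = min (l - s) b"
    have "\<tau> > 0" "\<tau> \<le> b" "\<tau> \<le> l - s" using that \<open>\<not> b \<le> 0\<close> by (auto simp: \<tau>_def)
    then have "\<tau> * (\<tau> - 2 * b) < 0" by (simp add: mult_pos_neg)
    moreover have "\<tau>\<^sup>2 - 2 * \<tau> * b \<ge> 0"
      using \<open>\<tau> > 0\<close> \<open>\<tau> \<le> l - s\<close> s by (intro step) auto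
    ultimately show False by (simp add: power2_eq_square algebra_simps)
  qed
qed

text \<open>The two sides of a corner are mirror images in the bisecting plane; \<open>v + s *\<^sub>R u'\<close> is the
  mirror image of the foot \<open>x\<close>, and \<open>\<nu>\<close> is the normal of that plane scaled such that \<open>\<nu> \<bullet> u = 1\<close>.\<close>

lemma corner_reflection:
  fixes p v u u' :: "'a::real_inner"
  assumes u: "norm u = 1" "norm u' = 1" and c: "u \<bullet> u' < 1"
    and \<nu>: "\<nu> = (u - u') /\<^sub>R (1 - u \<bullet> u')"
    and s: "0 \<le> s" "s \<le> l" and x: "x = v + s *\<^sub>R u"
    and near: "\<And>\<sigma>. 0 \<le> \<sigma> \<Longrightarrow> \<sigma> \<le> l \<Longrightarrow> dist p x \<le> dist p (v + \<sigma> *\<^sub>R u)"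
    and r: "dist p x \<le> r" "r * norm (\<nu> - u) < l' / 2" and l': "0 < l'"
    and side: "(p - v) \<bullet> \<nu> \<le> 0"
  shows "s \<le> l'"
    and "(dist q (v + s *\<^sub>R u'))\<^sup>2 - (dist q x)\<^sup>2 = 2 * s * (1 - u \<bullet> u') * ((q - v) \<bullet> \<nu>)"
proof -
  have uu: "u \<bullet> u = 1" "u' \<bullet> u' = 1" using u by (auto simp: norm_eq_1)
  have u\<nu>: "u \<bullet> \<nu> = 1" using c by (simp add: \<nu> inner_diff_right uu)
  show "s \<le> l'"
  proof (cases "s = 0")
    case False
    have "(p - x) \<bullet> u \<ge> 0"
      using foot_on_ray(1)[OF u(1) s, of p v] near False s unfolding x by auto
    then have a: "(p - v) \<bullet> u \<ge> s"
      by (simp add: x inner_diff_left inner_add_left uu)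
    \<comment> \<open>\<open>\<nu> - u\<close> is orthogonal to \<open>u\<close>, so
      \<open>x\<close> may replace \<open>v\<close> in the second term. For \<open>p\<close> beyond
      the bisecting plane this gives \<open>s \<le> r * norm (\<nu> - u)\<close>, hence
      \<open>s < l' / 2\<close>.\<close>
    have "(p - v) \<bullet> \<nu> = (p - v) \<bullet> u + (p - x) \<bullet> (\<nu> - u)"
      by (simp add: x inner_diff_left inner_diff_right inner_add_left uu u\<nu>)
    moreover have "\<bar>(p - x) \<bullet> (\<nu> - u)\<bar> \<le> norm (p - x) * norm (\<nu> - u)"
      by (rule Cauchy_Schwarz_ineq2)
    moreover have "norm (p - x) * norm (\<nu> - u) \<le> r * norm (\<nu> - u)"
      using r by (intro mult_right_mono) (auto simp: dist_norm)
    ultimately show ?thesis using a side r(2) l' by linarith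
  qed (use l' in simp)
  \<comment> \<open>Both points lie at distance \<open>s\<close> from \<open>v\<close>, so the
    quadratic terms cancel and the difference of squared distances is linear in \<open>q\<close>,
    with gradient along \<open>u - u'\<close>.\<close>
  have "(1 - u \<bullet> u') *\<^sub>R \<nu> = u - u'" using c by (simp add: \<nu>)
  then have e: "(1 - u \<bullet> u') * ((q - v) \<bullet> \<nu>) = (q - v) \<bullet> (u - u')"
    by (metis inner_scaleR_right)
  have "(dist q (v + s *\<^sub>R u'))\<^sup>2 - (dist q x)\<^sup>2 = 2 * s * ((q - v) \<bullet> (u - u'))"
    by (simp add: x dist_ray_sq uu inner_diff_right[of _ u u'] right_diff_distrib)
  then show "(dist q (v + s *\<^sub>R u'))\<^sup>2 - (dist q x)\<^sup>2 = 2 * s * (1 - u \<bullet> u') * ((q - v) \<bullet> \<nu>)"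
    using e by simp
qed

section \<open>Integer-indexed polygons and their bisecting planes\<close>

definition dir :: "(int \<Rightarrow> pt) \<Rightarrow> int \<Rightarrow> pt" where
  "dir V k = sgn (V (k + 1) - V k)"

definition len :: "(int \<Rightarrow> pt) \<Rightarrow> int \<Rightarrow> real" where
  "len V k = dist (V k) (V (k + 1))"

definition seg :: "(int \<Rightarrow> pt) \<Rightarrow> int \<Rightarrow> pt set" where
  "seg V k = closed_segment (V k) (V (k + 1))"

text \<open>Normal vector of the bisecting plane at vertex \<open>k\<close>; it has inner product 1 with both adjacent
  edge directions.\<close>

definition wall :: "(int \<Rightarrow> pt) \<Rightarrow> int \<Rightarrow> pt" where
  "wall V k = (dir V (k - 1) + dir V k) /\<^sub>R (1 + dir V (k - 1) \<bullet> dir V k)"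

text \<open>First-order condition for \<open>x\<close> to be a local minimum of the distance to \<open>y\<close> along the polygon.\<close>

definition locmin :: "(int \<Rightarrow> pt) \<Rightarrow> pt \<Rightarrow> pt \<Rightarrow> bool" where
  "locmin V y x \<longleftrightarrow> (\<exists>k.
     (x = V k \<and> (y - x) \<bullet> (V (k + 1) - V k) \<le> 0 \<and> (y - x) \<bullet> (V (k - 1) - V k) \<le> 0) \<or>
     (x \<in> open_segment (V k) (V (k + 1)) \<and> (y - x) \<bullet> (V (k + 1) - V k) = 0))"

definition adj :: "int \<Rightarrow> int \<Rightarrow> int \<Rightarrow> bool" where
  "adj n i j \<longleftrightarrow> n dvd i - j \<or> n dvd i - j - 1 \<or> n dvd i - j + 1"

text \<open>The vertices form a periodic sequence over the integers, so every edge has a predecessor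
  and a successor. \<open>norm (wall V k - dir V k)\<close> is the tangent of half the turning angle
  (\<open>wall_angle\<close>), so \<open>thick\<close> expresses \<open>r < MinRad\<close>;
  \<open>no_dc\<close> is what \<open>r < dcsd / 2\<close> says about pairs of mutually critical
  minima.\<close>

locale thick_polygon =
  fixes V :: "int \<Rightarrow> pt" and n :: int and r :: real
  assumes n3: "3 \<le> n"
    and per: "V (k + n) = V k"
    and neq: "V k \<noteq> V (k + 1)"
    and meet: "seg V k \<inter> seg V (k + 1) = {V (k + 1)}"
    and disj: "\<not> adj n i j \<Longrightarrow> seg V i \<inter> seg V j = {}"
    and r_pos: "0 < r"
    and thick: "r * norm (wall V k - dir V k) < len V k / 2"
      "r * norm (wall V k - dir V (k - 1)) < len V (k - 1) / 2"
      "r * norm (wall V k - dir V k) < len V (k - 1) / 2"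
      "r * norm (wall V k - dir V (k - 1)) < len V k / 2"
    and no_dc: "locmin V x y \<Longrightarrow> locmin V y x \<Longrightarrow> x \<noteq> y \<Longrightarrow> 2 * r < dist x y"
begin

abbreviation "U \<equiv> dir V"
abbreviation "L \<equiv> len V"
abbreviation "E \<equiv> seg V"
abbreviation "N \<equiv> wall V"

text \<open>Signed distance from the bisecting plane at vertex \<open>k\<close>, scaled to grow at
  unit rate along both adjacent edges in the direction of travel.\<close>

definition A :: "int \<Rightarrow> pt \<Rightarrow> real" where
  "A k p = (p - V k) \<bullet> N k"

definition C :: "int \<Rightarrow> pt set" where
  "C k = {p. (\<exists>x\<in>E k. dist p x \<le> r) \<and> 0 \<le> A k p \<and> A (k + 1) p \<le> 0}"

definition K :: "pt set" where
  "K = (\<Union>k. E k)"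

lemma L_pos: "0 < L k"
  using neq[of k] by (simp add: len_def)

lemma norm_U [simp]: "norm (U k) = 1"
  using neq[of k] by (simp add: dir_def norm_sgn)

lemma U_nonzero [simp]: "U k \<noteq> 0"
  using norm_U[of k] by fastforce

lemma UU [simp]: "U k \<bullet> U k = 1"
  using norm_U norm_eq_1 by blast

lemma V_Suc: "V (k + 1) = V k + L k *\<^sub>R U k"
  using neq[of k] by (simp add: len_def dir_def sgn_div_norm dist_norm norm_minus_commute)

lemma E_iff: "x \<in> E k \<longleftrightarrow> (\<exists>s. 0 \<le> s \<and> s \<le> L k \<and> x = V k + s *\<^sub>R U k)"
proof
  assume "x \<in> E k"
  then obtain t where t: "0 \<le> t" "t \<le> 1" "x = (1 - t) *\<^sub>R V k + t *\<^sub>R V (k + 1)"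
    by (auto simp: seg_def in_segment)
  then have "x = V k + (t * L k) *\<^sub>R U k"
      unfolding V_Suc by (simp add: algebra_simps)
  moreover have "0 \<le> t * L k" "t * L k \<le> L k" using t L_pos[of k] by auto
  ultimately show "\<exists>s. 0 \<le> s \<and> s \<le> L k \<and> x = V k + s *\<^sub>R U k" by blast
next
  assume "\<exists>s. 0 \<le> s \<and> s \<le> L k \<and> x = V k + s *\<^sub>R U k"
  then obtain s where s: "0 \<le> s" "s \<le> L k" "x = V k + s *\<^sub>R U k" by blast
  then have "x = (1 - s / L k) *\<^sub>R V k + (s / L k) *\<^sub>R V (k + 1)"
    using L_pos[of k] unfolding V_Suc by (simp add: algebra_simps)
  moreover have "0 \<le> s / L k" "s / L k \<le> 1" using s L_pos[of k] by auto
  ultimately show "x \<in> E k" by (auto simp: seg_def in_segment)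
qed

lemma E_iff': "x \<in> E k \<longleftrightarrow> (\<exists>s. 0 \<le> s \<and> s \<le> L k \<and> x = V (k + 1) + s *\<^sub>R (- U k))"
proof -
  have "(\<exists>s. 0 \<le> s \<and> s \<le> L k \<and> x = V (k + 1) + s *\<^sub>R (- U k)) \<longleftrightarrow>
        (\<exists>s. 0 \<le> s \<and> s \<le> L k \<and> x = V k + s *\<^sub>R U k)" (is "?l \<longleftrightarrow> ?r")
  proof
    assume ?l
    then obtain s where "0 \<le> s" "s \<le> L k" "x = V (k + 1) + s *\<^sub>R (- U k)" by blast
    then show ?r by (intro exI[of _ "L k - s"]) (simp add: V_Suc scaleR_left_diff_distrib)
  next
    assume ?r
    then obtain s where "0 \<le> s" "s \<le> L k" "x = V k + s *\<^sub>R U k" by blast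
    then show ?l by (intro exI[of _ "L k - s"]) (simp add: V_Suc scaleR_left_diff_distrib)
  qed
  then show ?thesis using E_iff by simp
qed

lemma V_in_E [simp]: "V k \<in> E k" "V (k + 1) \<in> E k" "V k \<in> E (k - 1)"
  by (auto simp: seg_def)

lemma compact_E [simp]: "compact (E k)" and closed_E [simp]: "closed (E k)"
  and convex_E [simp]: "convex (E k)" and E_nonempty [simp]: "E k \<noteq> {}"
  by (auto simp: seg_def)

text \<open>Opposite directions would make the two edges overlap beyond their common vertex. This
  keeps the denominator in \<open>wall\<close> positive.\<close>

lemma not_reversed: "0 < 1 + U (k - 1) \<bullet> U k"
proof (rule ccontr)
  assume a: "\<not> 0 < 1 + U (k - 1) \<bullet> U k"
  have "(U (k - 1) + U k) \<bullet> (U (k - 1) + U k) = 2 * (1 + U (k - 1) \<bullet> U k)"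
    by (simp add: inner_add_left inner_add_right inner_commute)
  with a have "(U (k - 1) + U k) \<bullet> (U (k - 1) + U k) \<le> 0" by simp
  then have "U (k - 1) + U k = 0"
    by (metis inner_ge_zero inner_eq_zero_iff order_antisym)
  then have U: "U (k - 1) = - U k" by (simp add: eq_neg_iff_add_eq_0)
  define m where "m = min (L (k - 1)) (L k)"
  have m: "m > 0" "m \<le> L (k - 1)" "m \<le> L k" using L_pos by (auto simp: m_def)
  have "V k + m *\<^sub>R U k \<in> E k" unfolding E_iff using m by (intro exI[of _ m]) auto
  moreover have "V k + m *\<^sub>R U k \<in> E (k - 1)"
    unfolding E_iff' using m U by (intro exI[of _ m]) auto
  ultimately have "V k + m *\<^sub>R U k = V k" using meet[of "k - 1"]
    by (metis Int_iff singletonD diff_add_cancel)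
  then have "U k = 0" using m by simp
  then show False using norm_U[of k] by simp
qed

lemma wall_dir [simp]: "U k \<bullet> N k = 1" "U k \<bullet> N (k + 1) = 1" "N k \<bullet> U k = 1" "N (k + 1) \<bullet> U k = 1"
proof -
  have "U k \<bullet> (U (k - 1) + U k) = 1 + U (k - 1) \<bullet> U k"
    by (simp add: inner_add_right inner_commute)
  then show 1: "U k \<bullet> N k = 1" using not_reversed[of k] by (simp add: wall_def)
  have "U k \<bullet> (U k + U (k + 1)) = 1 + U k \<bullet> U (k + 1)"
    by (simp add: inner_add_right inner_commute)
  then show 2: "U k \<bullet> N (k + 1) = 1" using not_reversed[of "k + 1"] by (simp add: wall_def)
  show "N k \<bullet> U k = 1" "N (k + 1) \<bullet> U k = 1" using 1 2 by (auto simp: inner_commute)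
qed

text \<open>\<open>A k p - A (k + 1) p\<close> equals \<open>L k\<close> up to two error terms, each
  below \<open>L k / 2\<close> by \<open>thick\<close>. So the bisecting planes at the ends of an
  edge do not meet inside its tube.\<close>

lemma A_strict_anti:
  assumes x: "x \<in> E k" and r: "dist p x \<le> r"
  shows "A (k + 1) p < A k p"
proof -
  obtain s where s: "x = V k + s *\<^sub>R U k" using x E_iff by blast
  have 1: "A k p = (p - V k) \<bullet> U k + (p - x) \<bullet> (N k - U k)"
    by (simp add: A_def s inner_diff_left inner_diff_right inner_add_left)
  have 2: "A (k + 1) p = (p - V k) \<bullet> U k - L k + (p - x) \<bullet> (N (k + 1) - U k)"
    by (simp add: A_def s V_Suc inner_diff_left inner_diff_right inner_add_left)
  have b: "\<bar>(p - x) \<bullet> w\<bar> \<le> r * norm w" for w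
    using Cauchy_Schwarz_ineq2[of "p - x" w] mult_right_mono[OF r, of "norm w"]
    by (simp add: dist_norm)
  have "norm (N (k + 1) - U k) * r < L k / 2" "norm (N k - U k) * r < L k / 2"
    using thick(2)[of "k + 1"] thick(1)[of k] by (auto simp: mult.commute)
  then show ?thesis using 1 2 b[of "N k - U k"] b[of "N (k + 1) - U k"]
    by (simp add: mult.commute abs_le_iff)
qed

text \<open>The corner at \<open>V k\<close> with \<open>u = U k\<close> and
  \<open>u' = - U (k - 1)\<close>; \<open>x'\<close> is the mirror image of the foot. As
  \<open>s > 0\<close> unless \<open>x\<close> is the vertex, the sign of \<open>A k q\<close>
  decides which of \<open>x\<close> and \<open>x'\<close> is nearer to \<open>q\<close>.\<close>

lemma reflect_back:
  assumes x: "x \<in> E k" and near: "\<forall>z\<in>E k. dist p x \<le> dist p z"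
    and r: "dist p x \<le> r" and side: "A k p \<le> 0"
  obtains x' s where "x' \<in> E (k - 1)" "0 \<le> s" "x = V k \<or> 0 < s"
    "\<forall>q. (dist q x')\<^sup>2 - (dist q x)\<^sup>2 = s * A k q"
proof -
  obtain s where s: "0 \<le> s" "s \<le> L k" "x = V k + s *\<^sub>R U k" using x E_iff by blast
  have c: "U k \<bullet> - U (k - 1) < 1" using not_reversed[of k] by (simp add: inner_commute)
  have \<nu>: "N k = (U k - - U (k - 1)) /\<^sub>R (1 - U k \<bullet> - U (k - 1))"
    by (simp add: wall_def inner_commute add.commute)
  have near': "dist p x \<le> dist p (V k + \<sigma> *\<^sub>R U k)" if "0 \<le> \<sigma>" "\<sigma> \<le> L k" for \<sigma>
    using near that E_iff by blast
  note R = corner_reflection[OF norm_U _ c \<nu> s near' r thick(3) L_pos]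
  have sl: "s \<le> L (k - 1)" using R(1) side by (simp add: A_def)
  show ?thesis
  proof (rule that[of "V k + s *\<^sub>R (- U (k - 1))" "2 * s * (1 + U (k - 1) \<bullet> U k)"])
    show "V k + s *\<^sub>R (- U (k - 1)) \<in> E (k - 1)" using E_iff'[of _ "k - 1"] s sl by auto
    show "0 \<le> 2 * s * (1 + U (k - 1) \<bullet> U k)" using s not_reversed[of k] by simp
    show "x = V k \<or> 0 < 2 * s * (1 + U (k - 1) \<bullet> U k)"
      using s not_reversed[of k] by (cases "s = 0") auto
    show "\<forall>q. (dist q (V k + s *\<^sub>R (- U (k - 1))))\<^sup>2 - (dist q x)\<^sup>2 =
        2 * s * (1 + U (k - 1) \<bullet> U k) * A k q"
      using R(2) side by (simp add: A_def inner_commute)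
  qed
qed

lemma reflect_forth:
  assumes x: "x \<in> E k" and near: "\<forall>z\<in>E k. dist p x \<le> dist p z"
    and r: "dist p x \<le> r" and side: "0 \<le> A (k + 1) p"
  obtains x' s where "x' \<in> E (k + 1)" "0 \<le> s" "x = V (k + 1) \<or> 0 < s"
    "\<forall>q. (dist q x')\<^sup>2 - (dist q x)\<^sup>2 = - s * A (k + 1) q"
proof -
  obtain s where s: "0 \<le> s" "s \<le> L k" "x = V (k + 1) + s *\<^sub>R (- U k)" using x E_iff' by blast
  have c: "- U k \<bullet> U (k + 1) < 1" using not_reversed[of "k + 1"] by simp
  \<comment> \<open>Seen from \<open>V (k + 1)\<close> the edge runs in direction
    \<open>- U k\<close>, so the normal at this corner is \<open>- N (k + 1)\<close>; hence the sign
    in \<open>- s\<close>.\<close>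
  have \<nu>: "- N (k + 1) = (- U k - U (k + 1)) /\<^sub>R (1 - - U k \<bullet> U (k + 1))"
    by (simp add: wall_def scaleR_right_diff_distrib scaleR_add_right)
  have near': "dist p x \<le> dist p (V (k + 1) + \<sigma> *\<^sub>R (- U k))" if "0 \<le> \<sigma>" "\<sigma> \<le> L k" for \<sigma>
    using near that E_iff' by blast
  have "norm (- N (k + 1) - - U k) = norm (N (k + 1) - U k)"
    by (metis minus_diff_eq norm_minus_cancel minus_diff_minus)
  then have th: "r * norm (- N (k + 1) - - U k) < L (k + 1) / 2" using thick(4)[of "k + 1"] by simp
  have nu: "norm (- U k) = 1" by simp
  note R = corner_reflection[OF nu norm_U c \<nu> s near' r th L_pos]
  have sl: "s \<le> L (k + 1)" using R(1) side by (simp add: A_def)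
  show ?thesis
  proof (rule that[of "V (k + 1) + s *\<^sub>R U (k + 1)" "2 * s * (1 + U k \<bullet> U (k + 1))"])
    show "V (k + 1) + s *\<^sub>R U (k + 1) \<in> E (k + 1)" using E_iff s sl by auto
    show "0 \<le> 2 * s * (1 + U k \<bullet> U (k + 1))" using s not_reversed[of "k + 1"] by simp
    show "x = V (k + 1) \<or> 0 < 2 * s * (1 + U k \<bullet> U (k + 1))"
      using s not_reversed[of "k + 1"] by (cases "s = 0") auto
    show "\<forall>q. (dist q (V (k + 1) + s *\<^sub>R U (k + 1)))\<^sup>2 - (dist q x)\<^sup>2 =
        - (2 * s * (1 + U k \<bullet> U (k + 1))) * A (k + 1) q"
      using R(2) side by (simp add: A_def)
  qed
qed

lemma nearest_E:
  obtains x where "x \<in> E k" "\<forall>z\<in>E k. dist p x \<le> dist p z" "infdist p (E k) = dist p x"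
proof -
  obtain x where "x \<in> E k" "infdist p (E k) = dist p x"
    using infdist_attains_inf[OF closed_E E_nonempty] .
  moreover from this have "\<forall>z\<in>E k. dist p x \<le> dist p z" using infdist_le[of _ "E k" p] by auto
  ultimately show ?thesis using that by blast
qed

lemma C_iff: "p \<in> C k \<longleftrightarrow> infdist p (E k) \<le> r \<and> 0 \<le> A k p \<and> A (k + 1) p \<le> 0"
proof -
  obtain x where "x \<in> E k" "infdist p (E k) = dist p x" using nearest_E .
  then have "(\<exists>x\<in>E k. dist p x \<le> r) \<longleftrightarrow> infdist p (E k) \<le> r"
    using infdist_le2[of _ "E k" p r] by auto
  then show ?thesis by (simp add: C_def)
qed

section \<open>Periodicity\<close>

lemma V_shift: "V (k + m * n) = V k"
proof -
  have nat: "V (k + int j * n) = V k" for j k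
  proof (induction j)
    case (Suc j)
    have "V (k + int (Suc j) * n) = V ((k + int j * n) + n)" by (simp add: algebra_simps)
    with Suc show ?case using per by simp
  qed simp
  show ?thesis
  proof (cases "m \<ge> 0")
    case True
    then show ?thesis using nat[of k "nat m"] by simp
  next
    case False
    then show ?thesis using nat[of "k + m * n" "nat (- m)"] by simp
  qed
qed

lemma shift:
  "U (k + m * n) = U k" "L (k + m * n) = L k" "E (k + m * n) = E k" "N (k + m * n) = N k"
  "A (k + m * n) p = A k p" "C (k + m * n) = C k"
proof -
  have 1: "V (k + m * n + 1) = V (k + 1)" for k using V_shift[of "k + 1" m] by (simp add: ac_simps)
  show U: "U (k + m * n) = U k" for k by (simp add: dir_def 1 V_shift)
  show "L (k + m * n) = L k" by (simp add: len_def 1 V_shift)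
  show E: "E (k + m * n) = E k" by (simp add: seg_def 1 V_shift)
  have U1: "U (k + m * n - 1) = U (k - 1)" for k using U[of "k - 1"] by (simp add: algebra_simps)
  show N: "N (k + m * n) = N k" for k by (simp add: wall_def U U1)
  show A: "A (k + m * n) p = A k p" for k p by (simp add: A_def N V_shift)
  have A1: "A (k + m * n + 1) p = A (k + 1) p" for p using A[of "k + 1"] by (simp add: algebra_simps)
  show "C (k + m * n) = C k" by (simp add: C_def E A A1)
qed

lemma cong_shift:
  assumes "n dvd i - j"
  obtains m where "i = j + m * n"
proof -
  obtain m where "i - j = n * m" using assms by (rule dvdE)
  then show ?thesis by (intro that[of m]) (simp add: algebra_simps)
qed

section \<open>Passing between neighbouring cells\<close>

lemma C_A: "p \<in> C k \<Longrightarrow> A (k + 1) p < A k p"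
  using A_strict_anti by (auto simp: C_def)

text \<open>On the bisecting plane \<open>p\<close> is equally far from its foot and from the mirror
  image of the foot on the previous edge; \<open>A_strict_anti\<close> for that edge puts
  \<open>p\<close> on the right side of its other plane.\<close>

lemma C_back:
  assumes "p \<in> C k" "A k p = 0"
  shows "p \<in> C (k - 1)"
proof -
  obtain x where x: "x \<in> E k" "\<forall>z\<in>E k. dist p x \<le> dist p z" "infdist p (E k) = dist p x"
    using nearest_E by blast
  have r: "dist p x \<le> r" using assms x C_iff by auto
  have "A k p \<le> 0" using assms by simp
  then obtain x' s where x': "x' \<in> E (k - 1)" "0 \<le> s" "x = V k \<or> 0 < s"
      "\<forall>q. (dist q x')\<^sup>2 - (dist q x)\<^sup>2 = s * A k q"
    by (rule reflect_back[OF x(1,2) r])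
  have "(dist p x')\<^sup>2 = (dist p x)\<^sup>2" using x'(4)[rule_format, of p] assms by simp
  then have "dist p x' \<le> r" using r by simp
  moreover from this have "A k p < A (k - 1) p" using A_strict_anti[OF x'(1)] by simp
  ultimately show ?thesis using x' assms by (auto simp: C_def)
qed

lemma C_forth:
  assumes "p \<in> C k" "A (k + 1) p = 0"
  shows "p \<in> C (k + 1)"
proof -
  obtain x where x: "x \<in> E k" "\<forall>z\<in>E k. dist p x \<le> dist p z" "infdist p (E k) = dist p x"
    using nearest_E by blast
  have r: "dist p x \<le> r" using assms x C_iff by auto
  have "0 \<le> A (k + 1) p" using assms by simp
  then obtain x' s where x': "x' \<in> E (k + 1)" "0 \<le> s" "x = V (k + 1) \<or> 0 < s"
      "\<forall>q. (dist q x')\<^sup>2 - (dist q x)\<^sup>2 = - s * A (k + 1) q"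
    by (rule reflect_forth[OF x(1,2) r])
  have "(dist p x')\<^sup>2 = (dist p x)\<^sup>2" using x'(4)[rule_format, of p] assms by simp
  then have "dist p x' \<le> r" using r by simp
  moreover from this have "A (k + 1 + 1) p < A (k + 1) p" using A_strict_anti[OF x'(1)] by simp
  ultimately show ?thesis using x' assms by (auto simp: C_def)
qed

text \<open>Lying in both \<open>C i\<close> and \<open>C k\<close> puts \<open>p\<close> before the
  plane at \<open>j\<close> and beyond the plane at \<open>k\<close>, against the order of these
  planes inside \<open>C j\<close>.\<close>

lemma C_triple: "p \<in> C i \<Longrightarrow> p \<in> C j \<Longrightarrow> p \<in> C k \<Longrightarrow> j = i + 1 \<Longrightarrow> k = j + 1 \<Longrightarrow> False"
  using C_A[of p j] by (auto simp: C_def)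

lemma continuous_A [continuous_intros]: "continuous_on S (A k)"
  unfolding A_def by (intro continuous_intros)

lemma A_eventually:
  "0 < A k p \<Longrightarrow> \<forall>\<^sub>F q in nhds p. 0 < A k q" "A k p < 0 \<Longrightarrow> \<forall>\<^sub>F q in nhds p. A k q < 0"
proof -
  have "(A k \<longlongrightarrow> A k p) (nhds p)"
    unfolding A_def by (intro tendsto_inner tendsto_diff tendsto_const filterlim_ident)
  then show "0 < A k p \<Longrightarrow> \<forall>\<^sub>F q in nhds p. 0 < A k q" "A k p < 0 \<Longrightarrow> \<forall>\<^sub>F q in nhds p. A k q < 0"
    by (auto simp: order_tendsto_iff)
qed

text \<open>A point that leaves a cell through a bisecting plane enters the neighbouring cell, and gets
  closer to the neighbouring edge than to the one it leaves.\<close>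

lemma local_cells:
  assumes p: "p \<in> C k" and x: "x \<in> E k" "\<forall>z\<in>E k. dist p x \<le> dist p z"
  shows "\<forall>\<^sub>F q in nhds p. dist q x \<le> r \<longrightarrow>
    (\<exists>k'\<in>{k - 1, k, k + 1}. p \<in> C k' \<and> q \<in> C k' \<and> (\<exists>x'\<in>E k'. dist q x' \<le> dist q x))"
proof -
  have r: "dist p x \<le> r"
  proof -
    obtain z where "z \<in> E k" "dist p z \<le> r" using p by (auto simp: C_def)
    then show ?thesis using x(2) by fastforce
  qed
  have Ap: "0 \<le> A k p" "A (k + 1) p \<le> 0" "A (k + 1) p < A k p"
    using p C_A by (auto simp: C_def)
  \<comment> \<open>Since \<open>A (k + 1) p < A k p\<close>, at most one of the two bisecting
    planes passes through \<open>p\<close>.\<close>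
  consider "0 < A k p" "A (k + 1) p < 0" | "A k p = 0" "A (k + 1) p < 0" | "0 < A k p" "A (k + 1) p = 0"
    using Ap by linarith
  then show ?thesis
  proof cases
    case 1
    show ?thesis
      using A_eventually(1)[OF 1(1)] A_eventually(2)[OF 1(2)]
    proof eventually_elim
      case (elim q)
      then show ?case using p x by (intro impI bexI[of _ k]) (auto simp: C_def)
    qed
  next
    case 2
    have "A k p \<le> 0" using 2 by simp
    then obtain x' s where x': "x' \<in> E (k - 1)" "0 \<le> s" "x = V k \<or> 0 < s"
        "\<forall>q. (dist q x')\<^sup>2 - (dist q x)\<^sup>2 = s * A k q"
      by (rule reflect_back[OF x r])
    have pC: "p \<in> C (k - 1)" using C_back p 2 by blast
    then have "0 < A (k - 1) p" using C_A[of p "k - 1"] 2 by simp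
    from A_eventually(1)[OF this] A_eventually(2)[OF 2(2)] show ?thesis
    proof eventually_elim
      case (elim q)
      show ?case
      proof
        assume q: "dist q x \<le> r"
        show "\<exists>k'\<in>{k - 1, k, k + 1}. p \<in> C k' \<and> q \<in> C k' \<and> (\<exists>x'\<in>E k'. dist q x' \<le> dist q x)"
        proof (cases "0 \<le> A k q")
          case True
          then show ?thesis using p x elim q by (intro bexI[of _ k]) (auto simp: C_def)
        next
          case False
          then have "s * A k q \<le> 0" using x'(2) by (simp add: mult_nonneg_nonpos)
          then have "(dist q x')\<^sup>2 \<le> (dist q x)\<^sup>2" using x'(4)[rule_format, of q] by linarith
          then have "dist q x' \<le> dist q x" by (rule power2_le_imp_le) simp
          then show ?thesis using False pC x'(1) elim q
            by (intro bexI[of _ "k - 1"]) (auto simp: C_def intro!: bexI[of _ x'])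
        qed
      qed
    qed
  next
    case 3
    have "0 \<le> A (k + 1) p" using 3 by simp
    then obtain x' s where x': "x' \<in> E (k + 1)" "0 \<le> s" "x = V (k + 1) \<or> 0 < s"
        "\<forall>q. (dist q x')\<^sup>2 - (dist q x)\<^sup>2 = - s * A (k + 1) q"
      by (rule reflect_forth[OF x r])
    have pC: "p \<in> C (k + 1)" using C_forth p 3 by blast
    then have "A (k + 1 + 1) p < 0" using C_A[of p "k + 1"] 3 by simp
    from A_eventually(2)[OF this] A_eventually(1)[OF 3(1)] show ?thesis
    proof eventually_elim
      case (elim q)
      show ?case
      proof
        assume q: "dist q x \<le> r"
        show "\<exists>k'\<in>{k - 1, k, k + 1}. p \<in> C k' \<and> q \<in> C k' \<and> (\<exists>x'\<in>E k'. dist q x' \<le> dist q x)"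
        proof (cases "A (k + 1) q \<le> 0")
          case True
          then show ?thesis using p x elim q by (intro bexI[of _ k]) (auto simp: C_def)
        next
          case False
          then have "- s * A (k + 1) q \<le> 0" using x'(2) by (simp add: mult_nonneg_nonneg)
          then have "(dist q x')\<^sup>2 \<le> (dist q x)\<^sup>2" using x'(4)[rule_format, of q] by linarith
          then have "dist q x' \<le> dist q x" by (rule power2_le_imp_le) simp
          then show ?thesis using False pC x'(1) elim q
            by (intro bexI[of _ "k + 1"]) (auto simp: C_def intro!: bexI[of _ x'])
        qed
      qed
    qed
  qed
qed

lemma adj_cases:
  assumes "adj n i j"
  obtains m d where "i = j + d + m * n" "d \<in> {-1, 0, 1}"
proof -
  from assms consider "n dvd i - j" | "n dvd i - (j + 1)" | "n dvd i - (j - 1)"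
    by (auto simp: adj_def algebra_simps)
  then show ?thesis
  proof cases
    case 1
    then obtain m where "i = j + m * n" by (rule cong_shift)
    then show ?thesis by (intro that[of 0 m]) auto
  next
    case 2
    then obtain m where "i = j + 1 + m * n" by (rule cong_shift)
    then show ?thesis by (intro that[of 1 m]) auto
  next
    case 3
    then obtain m where "i = j - 1 + m * n" by (rule cong_shift)
    then show ?thesis by (intro that[of "-1" m]) auto
  qed
qed

text \<open>If \<open>i'\<close> and \<open>j'\<close> were adjacent, then \<open>j\<close>,
  \<open>j'\<close>, \<open>i'\<close>, \<open>i\<close> would form, modulo \<open>n\<close>, a walk
  with steps of size at most one through cells containing \<open>p\<close>. As \<open>i\<close> and
  \<open>j\<close> are not adjacent, its ends are at least two apart, so it visits three consecutive
  cells, contrary to \<open>C_triple\<close>.\<close>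

lemma not_adj_neighbours:
  assumes "\<not> adj n i j" and p: "p \<in> C i" "p \<in> C j" "p \<in> C i'" "p \<in> C j'"
    and i': "i' \<in> {i - 1, i, i + 1}" and j': "j' \<in> {j - 1, j, j + 1}"
  shows "\<not> adj n i' j'"
proof
  assume "adj n i' j'"
  then obtain m d where md: "i' = j' + d + m * n" "d \<in> {-1, 0, 1}" using adj_cases by blast
  define e where "e = j' - j"
  define f where "f = i' - i"
  define a where "a = j + m * n"
  have e: "e \<in> {-1, 0, 1}" and f: "f \<in> {-1, 0, 1}" using i' j' by (auto simp: e_def f_def)
  have i: "i = a + (e + d - f)" by (simp add: e_def f_def a_def md)
  have C: "p \<in> C a" "p \<in> C (a + e)" "p \<in> C (a + (e + d))" "p \<in> C (a + (e + d - f))"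
  proof -
    show "p \<in> C a" using p by (simp add: a_def shift)
    have "a + e = j' + m * n" by (simp add: a_def e_def)
    then show "p \<in> C (a + e)" using p by (simp add: shift)
    have "a + (e + d) = i'" by (simp add: a_def e_def md)
    then show "p \<in> C (a + (e + d))" using p by simp
    show "p \<in> C (a + (e + d - f))" using p i by simp
  qed
  have ij: "e + d - f \<notin> {-1, 0, 1}"
  proof -
    have "i - j = (e + d - f) + m * n" by (simp add: i a_def)
    then have "i - j = m * n + (e + d - f)" "i - j - 1 = m * n + (e + d - f - 1)"
      "i - j + 1 = m * n + (e + d - f + 1)" by simp_all
    then have "n dvd i - j \<longleftrightarrow> n dvd (e + d - f)"
      "n dvd i - j - 1 \<longleftrightarrow> n dvd (e + d - f - 1)" "n dvd i - j + 1 \<longleftrightarrow> n dvd (e + d - f + 1)"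
      by (simp_all only: dvd_add_right_iff dvd_triv_right)
    then show ?thesis using assms(1) by (auto simp: adj_def)
  qed
  define Q where "Q z \<longleftrightarrow> p \<in> C (a + z)" for z
  have T: "\<not> (Q z \<and> Q (z + 1) \<and> Q (z + 2))" for z
    unfolding Q_def by (intro notI, elim conjE, erule (2) C_triple) simp_all
  have Q: "Q 0" "Q e" "Q (e + d)" "Q (e + d - f)" using C by (auto simp: Q_def)
  \<comment> \<open>The three steps stay between -3 and 3, so a triple of consecutive positions
    starts between -3 and 1.\<close>
  show False using e f md(2) ij Q T[of "-3"] T[of "-2"] T[of "-1"] T[of 0] T[of 1]
    by (simp only: insert_iff empty_iff simp_thms) (elim conjE disjE; simp)
qed

section \<open>Disjointness of the cells\<close>

lemma E_subset_K: "E k \<subseteq> K"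
  by (auto simp: K_def)

text \<open>Were \<open>p\<close> beyond a bisecting plane of an edge through \<open>x\<close>, the
  mirror image of \<open>x\<close> would be strictly nearer to \<open>p\<close>, unless
  \<open>x\<close> is the vertex in that plane.\<close>

lemma nearest_cell:
  assumes x: "x \<in> K" and near: "\<forall>z\<in>K. dist p x \<le> dist p z" and r: "dist p x \<le> r"
  obtains k where "x \<in> E k" "p \<in> C k"
proof -
  obtain j where "x \<in> E j" using x by (auto simp: K_def)
  \<comment> \<open>Taking an edge that does not end at \<open>x\<close> leaves its start as the
    only exceptional vertex.\<close>
  then obtain k where k: "x \<in> E k" "x \<noteq> V (k + 1)"
    using V_in_E(1)[of "j + 1"] neq[of "j + 1"] by metis
  have nearE: "\<forall>z\<in>E k. dist p x \<le> dist p z" for k using near E_subset_K by blast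
  have closer: False if "x' \<in> E i" "(dist p x')\<^sup>2 - (dist p x)\<^sup>2 < 0" for i x'
  proof -
    have "(dist p x')\<^sup>2 < (dist p x)\<^sup>2" using that by linarith
    then have "dist p x' < dist p x" by (rule power2_less_imp_less) simp
    then show False using nearE[of i] that by auto
  qed
  have at_start: "x = V i" if i: "x \<in> E i" "A i p < 0" for i
  proof (rule ccontr)
    assume ne: "x \<noteq> V i"
    have "A i p \<le> 0" using i by simp
    then obtain x' s where x': "x' \<in> E (i - 1)" "0 \<le> s" "x = V i \<or> 0 < s"
      "\<forall>q. (dist q x')\<^sup>2 - (dist q x)\<^sup>2 = s * A i q"
      by (rule reflect_back[OF i(1) nearE r])
    have "s * A i p < 0" using x' ne i by (simp add: mult_pos_neg)
    then show False using closer[OF x'(1)] x'(4) by simp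
  qed
  have before_end: "A (k + 1) p \<le> 0"
  proof (rule ccontr)
    assume a: "\<not> A (k + 1) p \<le> 0"
    then have "0 \<le> A (k + 1) p" by simp
    then obtain x' s where x': "x' \<in> E (k + 1)" "0 \<le> s" "x = V (k + 1) \<or> 0 < s"
      "\<forall>q. (dist q x')\<^sup>2 - (dist q x)\<^sup>2 = - s * A (k + 1) q"
      by (rule reflect_forth[OF k(1) nearE r])
    have "- s * A (k + 1) p < 0" using x' k a by simp
    then show False using closer[OF x'(1)] x'(4) by simp
  qed
  show ?thesis
  proof (cases "0 \<le> A k p")
    case True
    then show ?thesis using that[of k] k before_end r by (auto simp: C_def)
  next
    case False
    \<comment> \<open>Here \<open>x\<close> is the start of the edge and the preceding edge takes
      over: \<open>p\<close> lies before its end plane, and not before its start plane because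
      \<open>x\<close> differs from \<open>V (k - 1)\<close>.\<close>
    then have xk: "x = V k" using at_start k by simp
    then have "x \<in> E (k - 1)" by simp
    moreover have "0 \<le> A (k - 1) p"
    proof (rule ccontr)
      assume "\<not> 0 \<le> A (k - 1) p"
      then have "x = V (k - 1)" using at_start calculation by simp
      then show False using xk neq[of "k - 1"] by simp
    qed
    ultimately show ?thesis using that[of "k - 1"] False r by (auto simp: C_def)
  qed
qed

lemma A_eq: "(1 + U (k - 1) \<bullet> U k) * A k p = (p - V k) \<bullet> U (k - 1) + (p - V k) \<bullet> U k"
proof -
  have "(1 + U (k - 1) \<bullet> U k) *\<^sub>R N k = U (k - 1) + U k"
    using not_reversed[of k] by (simp add: wall_def)
  then show ?thesis by (metis A_def inner_scaleR_right inner_add_right)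
qed

lemma A_nonneg_iff: "0 \<le> A k p \<longleftrightarrow> 0 \<le> (p - V k) \<bullet> U (k - 1) + (p - V k) \<bullet> U k"
  and A_nonpos_iff: "A k p \<le> 0 \<longleftrightarrow> (p - V k) \<bullet> U (k - 1) + (p - V k) \<bullet> U k \<le> 0"
  unfolding A_eq[symmetric] using not_reversed[of k]
  by (simp_all add: zero_le_mult_iff mult_le_0_iff)

text \<open>\<open>y\<close> is the point reflection of \<open>x\<close> in \<open>p\<close>, so
  sign conditions on \<open>p - x\<close> carry over. At a vertex, minimality on \<open>E k\<close>
  gives the sign of one inner product; the sign of \<open>A\<close>, a positive multiple of the sum
  of both, then gives the other.\<close>

lemma nearest_locmin:
  assumes p: "p \<in> C k" and x: "x \<in> E k" "\<forall>z\<in>E k. dist p x \<le> dist p z"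
    and y: "y - x = 2 *\<^sub>R (p - x)"
  shows "locmin V y x"
proof -
  obtain s where s: "0 \<le> s" "s \<le> L k" "x = V k + s *\<^sub>R U k" using x E_iff by blast
  have near: "dist p (V k + s *\<^sub>R U k) \<le> dist p (V k + \<sigma> *\<^sub>R U k)" if "0 \<le> \<sigma>" "\<sigma> \<le> L k" for \<sigma>
    using x that E_iff s by blast
  have f: "0 < s \<Longrightarrow> 0 \<le> (p - x) \<bullet> U k" "s < L k \<Longrightarrow> (p - x) \<bullet> U k \<le> 0"
    using foot_on_ray[OF norm_U s(1,2) near] s(3) by auto
  have d: "V (k + 1) - V k = L k *\<^sub>R U k" for k by (simp add: V_Suc)
  have d': "V (k - 1) - V k = - (L (k - 1) *\<^sub>R U (k - 1))" for k using V_Suc[of "k - 1"] by simp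
  have Ap: "0 \<le> A k p" "A (k + 1) p \<le> 0" using p by (auto simp: C_def)
  consider "s = 0" | "s = L k" | "0 < s" "s < L k" using s by linarith
  then show ?thesis
  proof cases
    case 1
    then have "x = V k" using s by simp
    moreover have "(p - x) \<bullet> U k \<le> 0" using f 1 L_pos by simp
    moreover have "0 \<le> (p - x) \<bullet> U (k - 1)"
      using Ap(1) calculation unfolding A_nonneg_iff by simp
    ultimately show ?thesis
      unfolding locmin_def y d d' using L_pos[of k] L_pos[of "k - 1"]
      by (intro exI[of _ k] disjI1) (simp add: mult_nonneg_nonpos)
  next
    case 2
    then have xk: "x = V (k + 1)" using s V_Suc by simp
    moreover have "0 \<le> (p - x) \<bullet> U k" using f 2 L_pos by simp
    moreover have "(p - x) \<bullet> U (k + 1) \<le> 0"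
      using Ap(2) calculation unfolding A_nonpos_iff by simp
    ultimately show ?thesis
      unfolding locmin_def y d d' using L_pos[of k] L_pos[of "k + 1"]
      by (intro exI[of _ "k + 1"] disjI1) (simp add: mult_nonneg_nonpos)
  next
    case 3
    then have "(p - x) \<bullet> U k = 0" using f by auto
    moreover have "x \<in> open_segment (V k) (V (k + 1))"
      using x 3 s(3) by (auto simp: open_segment_def seg_def V_Suc)
    ultimately show ?thesis
      unfolding locmin_def y d d' by (intro exI[of _ k] disjI2) simp
  qed
qed

lemma compact_C: "compact (C k)"
proof -
  have "C k = {p. infdist p (E k) \<le> r} \<inter> ({p. 0 \<le> A k p} \<inter> {p. A (k + 1) p \<le> 0})"
    by (auto simp: C_iff)
  moreover have "closed {p. 0 \<le> A k p}" "closed {p. A (k + 1) p \<le> 0}"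
    by (intro closed_Collect_le continuous_intros)+
  ultimately show ?thesis using compact_infdist_le[OF E_nonempty compact_E r_pos] by (simp add: closed_Int compact_Int_closed)
qed

lemma C_mod: "C (k mod n) = C k" and E_mod: "E (k mod n) = E k"
proof -
  have "k mod n + (k div n) * n = k" by (simp add: add.commute)
  then show "C (k mod n) = C k" "E (k mod n) = E k" using shift(3,6)[of "k mod n" "k div n"] by auto
qed

text \<open>At a point common to two non-adjacent cells where the larger of the distances to the two edges
  is minimal, the feet on the edges are antipodal, so that they form a doubly critical pair.\<close>

lemma cells_disjoint:
  assumes "\<not> adj n i\<^sub>0 j\<^sub>0"
  shows "C i\<^sub>0 \<inter> C j\<^sub>0 = {}"
proof (rule ccontr)
  assume "C i\<^sub>0 \<inter> C j\<^sub>0 \<noteq> {}"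
  \<comment> \<open>Indices modulo \<open>n\<close> range over a finite set, so \<open>Z\<close> is
    compact. Minimising also over points of the two edges accounts for the distances to the edges by
    an explicit continuous \<open>f\<close>.\<close>
  define J where "J = {(i mod n, j mod n) |i j. \<not> adj n i j}"
  define Z where "Z = (\<Union>(i, j)\<in>J. (C i \<inter> C j) \<times> (E i \<times> E j))"
  define f where "f z = max (dist (fst z) (fst (snd z))) (dist (fst z) (snd (snd z)))" for z :: "pt \<times> pt \<times> pt"
  have Z_intro: "(p, x, y) \<in> Z" if "\<not> adj n i j" "p \<in> C i" "p \<in> C j" "x \<in> E i" "y \<in> E j" for p x y i j
  proof -
    have "(i mod n, j mod n) \<in> J" using that J_def by blast
    then show ?thesis unfolding Z_def using that by (intro UN_I[of "(i mod n, j mod n)"]) (auto simp: C_mod E_mod)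
  qed
  have "J \<subseteq> {0..<n} \<times> {0..<n}" using n3 by (auto simp: J_def)
  then have "finite J" by (rule finite_subset) simp
  then have "compact Z"
    unfolding Z_def by (intro compact_UN) (auto intro!: compact_Times compact_Int compact_C)
  moreover have "Z \<noteq> {}"
  proof -
    obtain p where "p \<in> C i\<^sub>0 \<inter> C j\<^sub>0" using \<open>C i\<^sub>0 \<inter> C j\<^sub>0 \<noteq> {}\<close> by blast
    then have "(p, V i\<^sub>0, V j\<^sub>0) \<in> Z" using assms by (intro Z_intro) auto
    then show ?thesis by blast
  qed
  moreover have "continuous_on Z f" unfolding f_def by (intro continuous_intros)
  ultimately obtain z where z: "z \<in> Z" "\<forall>w\<in>Z. f z \<le> f w"
    using continuous_attains_inf[of Z f] by blast
  obtain p x\<^sub>1 y\<^sub>1 i j where zp: "z = (p, x\<^sub>1, y\<^sub>1)" and ij: "\<not> adj n i j"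
    and p: "p \<in> C i" "p \<in> C j" and xy1: "x\<^sub>1 \<in> E i" "y\<^sub>1 \<in> E j"
    using z(1) by (auto simp: Z_def J_def C_mod E_mod)
  obtain x where x: "x \<in> E i" "\<forall>w\<in>E i. dist p x \<le> dist p w" "infdist p (E i) = dist p x"
    by (rule nearest_E)
  obtain y where y: "y \<in> E j" "\<forall>w\<in>E j. dist p y \<le> dist p w" "infdist p (E j) = dist p y"
    by (rule nearest_E)
  define M where "M = max (dist p x) (dist p y)"
  have pM: "dist p x \<le> M" "dist p y \<le> M" by (auto simp: M_def)
  have "M \<le> f z" using x(2) y(2) xy1 unfolding M_def f_def zp fst_conv snd_conv
    by (intro max.mono) auto
  then have M_min: "M \<le> max (dist q x') (dist q y')"
    if "\<not> adj n i' j'" "q \<in> C i'" "q \<in> C j'" "x' \<in> E i'" "y' \<in> E j'" for q x' y' i' j'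
    using z(2) Z_intro[OF that] by (auto simp: f_def)
  have Mr: "M \<le> r" using p x y by (auto simp: C_iff M_def)
  have "x \<noteq> y" using disj[OF ij] x y by blast
  show False
  proof (cases "dist x y < 2 * M")
    case True
    \<comment> \<open>The midpoint of the feet is nearer than \<open>M\<close> to both, so by
      convexity every step from \<open>p\<close> towards it brings both distances below
      \<open>M\<close>. For a small step \<open>local_cells\<close> supplies the cells.\<close>
    define m where "m = midpoint x y"
    define q where "q \<epsilon> = p + \<epsilon> *\<^sub>R (m - p)" for \<epsilon> :: real
    have q_close: "dist (q \<epsilon>) w < M" if \<epsilon>: "0 < \<epsilon>" "\<epsilon> < 1" and w: "w \<in> {x, y}" for \<epsilon> w
    proof -
      have "q \<epsilon> - w = (1 - \<epsilon>) *\<^sub>R (p - w) + \<epsilon> *\<^sub>R (m - w)"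
        by (simp add: q_def algebra_simps)
      then have "dist (q \<epsilon>) w \<le> (1 - \<epsilon>) * dist p w + \<epsilon> * dist m w"
        using norm_triangle_ineq[of "(1 - \<epsilon>) *\<^sub>R (p - w)" "\<epsilon> *\<^sub>R (m - w)"] \<epsilon>
        by (simp add: dist_norm)
      also have "\<dots> \<le> (1 - \<epsilon>) * M + \<epsilon> * dist m w"
        using \<epsilon> pM w by (intro add_right_mono mult_left_mono) auto
      also have "\<dots> < (1 - \<epsilon>) * M + \<epsilon> * M"
        using \<epsilon> True w by (auto simp: m_def dist_midpoint)
      finally show ?thesis by (simp add: algebra_simps)
    qed
    have lim: "filterlim q (nhds p) (at_right 0)"
    proof -
      have "((\<lambda>\<epsilon>. p + \<epsilon> *\<^sub>R (m - p)) \<longlongrightarrow> p + 0 *\<^sub>R (m - p)) (at_right 0)"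
        by (intro tendsto_intros)
      then show ?thesis by (simp add: q_def[abs_def])
    qed
    have ev: "\<forall>\<^sub>F \<epsilon> in at_right (0::real). 0 < \<epsilon> \<and> \<epsilon> < 1"
      using eventually_at_right_real[of 0 1] by simp
    have "\<forall>\<^sub>F \<epsilon> in at_right 0. \<exists>i' j' x' y'. \<not> adj n i' j' \<and> q \<epsilon> \<in> C i' \<and> q \<epsilon> \<in> C j' \<and>
        x' \<in> E i' \<and> y' \<in> E j' \<and> dist (q \<epsilon>) x' < M \<and> dist (q \<epsilon>) y' < M"
      using ev eventually_compose_filterlim[OF local_cells[OF p(1) x(1,2)] lim]
        eventually_compose_filterlim[OF local_cells[OF p(2) y(1,2)] lim]
    proof eventually_elim
      case (elim \<epsilon>)
      then have q: "dist (q \<epsilon>) x < M" "dist (q \<epsilon>) y < M" using q_close by auto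
      with elim Mr obtain i' x' where i': "i' \<in> {i - 1, i, i + 1}" "p \<in> C i'" "q \<epsilon> \<in> C i'"
        "x' \<in> E i'" "dist (q \<epsilon>) x' \<le> dist (q \<epsilon>) x" by auto
      from q elim Mr obtain j' y' where j': "j' \<in> {j - 1, j, j + 1}" "p \<in> C j'" "q \<epsilon> \<in> C j'"
        "y' \<in> E j'" "dist (q \<epsilon>) y' \<le> dist (q \<epsilon>) y" by auto
      have "\<not> adj n i' j'" using not_adj_neighbours[OF ij p i'(2) j'(2) i'(1) j'(1)] .
      moreover have "dist (q \<epsilon>) x' < M" "dist (q \<epsilon>) y' < M" using q i' j' by auto
      ultimately show ?case using i' j' by blast
    qed
    then obtain \<epsilon> i' j' x' y' where "\<not> adj n i' j'" "q \<epsilon> \<in> C i'" "q \<epsilon> \<in> C j'"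
        "x' \<in> E i'" "y' \<in> E j'" "dist (q \<epsilon>) x' < M" "dist (q \<epsilon>) y' < M"
      using eventually_happens'[OF trivial_limit_at_right_real] by blast
    then show False using M_min[of i' j' "q \<epsilon>" x' y'] by simp
  next
    case False
    \<comment> \<open>Parallelogram law for \<open>p - x\<close> and \<open>p - y\<close>: both
      squared norms are at most \<open>M\<^sup>2\<close>, while that of the difference is already at
      least \<open>4 * M\<^sup>2\<close>. So the sum vanishes and \<open>p\<close> is the
      midpoint.\<close>
    have "(norm (a + b))\<^sup>2 + (norm (a - b))\<^sup>2 = 2 * (norm a)\<^sup>2 + 2 * (norm b)\<^sup>2" for a b :: pt
      by (simp add: power2_norm_eq_inner inner_add_left inner_add_right inner_diff_left inner_diff_right)
    then have "(norm ((p - x) + (p - y)))\<^sup>2 + (norm ((p - x) - (p - y)))\<^sup>2 =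
        2 * (norm (p - x))\<^sup>2 + 2 * (norm (p - y))\<^sup>2" .
    moreover have "(norm (p - x))\<^sup>2 \<le> M\<^sup>2" "(norm (p - y))\<^sup>2 \<le> M\<^sup>2"
      using pM by (auto simp: dist_norm intro!: power_mono)
    moreover have "4 * M\<^sup>2 \<le> (norm ((p - x) - (p - y)))\<^sup>2"
    proof -
      have "(2 * M)\<^sup>2 \<le> (dist x y)\<^sup>2"
        using False order_trans[OF zero_le_dist pM(1)] by (intro power_mono) auto
      then show ?thesis by (simp add: dist_norm norm_minus_commute power_mult_distrib)
    qed
    ultimately have "(norm ((p - x) + (p - y)))\<^sup>2 \<le> 0" by linarith
    then have "(p - x) + (p - y) = 0" by simp
    then have "y - x = 2 *\<^sub>R (p - x)" "x - y = 2 *\<^sub>R (p - y)"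
      by (auto simp: scaleR_2 algebra_simps)
    then have "locmin V y x" "locmin V x y"
      using nearest_locmin[OF p(1) x(1,2)] nearest_locmin[OF p(2) y(1,2)] by auto
    then have "2 * r < dist x y" using no_dc \<open>x \<noteq> y\<close> by blast
    also have "dist x y \<le> dist p x + dist p y" by (metis dist_commute dist_triangle)
    finally show False using pM Mr by simp
  qed
qed

end

section \<open>The disc bundle structure\<close>

text \<open>\<open>\<nu>\<close>, \<open>cross3 w \<nu>\<close> and
  \<open>cross3 \<nu> (cross3 w \<nu>)\<close> form an orthogonal frame; by Lagrange's identity a
  vector orthogonal to the first two has zero cross product with the third.\<close>

lemma frame_eq_0:
  fixes \<nu> w \<xi> :: "real^3"
  assumes "cross3 w \<nu> \<noteq> 0" "\<xi> \<bullet> \<nu> = 0" "\<xi> \<bullet> cross3 w \<nu> = 0" "\<xi> \<bullet> cross3 \<nu> (cross3 w \<nu>) = 0"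
  shows "\<xi> = 0"
proof -
  have "cross3 \<xi> (cross3 \<nu> (cross3 w \<nu>)) = 0" using assms by (simp add: Lagrange[of \<xi>])
  moreover have "cross3 \<nu> (cross3 w \<nu>) \<noteq> 0"
    using assms(1) norm_and_cross_eq_0[of \<nu> "cross3 w \<nu>"] dot_cross_self by auto
  ultimately show ?thesis using assms(4) norm_and_cross_eq_0 by blast
qed

lemma frame_solve:
  fixes \<nu> w :: "real^3"
  assumes "cross3 w \<nu> \<noteq> 0"
  obtains \<xi> where "\<xi> \<bullet> \<nu> = 0" "\<xi> \<bullet> cross3 w \<nu> = a" "\<xi> \<bullet> cross3 \<nu> (cross3 w \<nu>) = b"
proof -
  define e where "e = cross3 w \<nu>"
  define f where "f = cross3 \<nu> e"
  have o: "e \<bullet> \<nu> = 0" "f \<bullet> \<nu> = 0" "e \<bullet> f = 0" "f \<bullet> e = 0"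
    by (simp_all add: e_def f_def dot_cross_self inner_commute)
  have ne: "e \<bullet> e \<noteq> 0" "f \<bullet> f \<noteq> 0"
    using assms norm_and_cross_eq_0[of \<nu> e] o by (auto simp: e_def f_def inner_commute)
  show ?thesis
    by (rule that[of "(a / (e \<bullet> e)) *\<^sub>R e + (b / (f \<bullet> f)) *\<^sub>R f"])
       (use o ne in \<open>simp_all add: inner_add_left flip: e_def f_def\<close>)
qed

text \<open>\<open>sgn\<close> jumps at zero but is bounded by 1, and at zeros of
  \<open>\<zeta>\<close> the factor \<open>\<rho>\<close> tends to 0. This makes polar coordinates
  continuous at the core.\<close>

lemma continuous_on_scaleR_sgn:
  fixes \<zeta> :: "'a::topological_space \<Rightarrow> 'b::real_normed_vector"
  assumes "continuous_on S \<rho>" "continuous_on S \<zeta>" "\<And>x. x \<in> S \<Longrightarrow> \<zeta> x = 0 \<Longrightarrow> \<rho> x = 0"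
  shows "continuous_on S (\<lambda>x. \<rho> x *\<^sub>R sgn (\<zeta> x))"
  unfolding continuous_on_def
proof
  fix x assume x: "x \<in> S"
  have \<rho>: "(\<rho> \<longlongrightarrow> \<rho> x) (at x within S)" and \<zeta>: "(\<zeta> \<longlongrightarrow> \<zeta> x) (at x within S)"
    using assms x by (auto simp: continuous_on_def)
  show "((\<lambda>x. \<rho> x *\<^sub>R sgn (\<zeta> x)) \<longlongrightarrow> \<rho> x *\<^sub>R sgn (\<zeta> x)) (at x within S)"
  proof (cases "\<zeta> x = 0")
    case True
    then have "\<rho> x = 0" using assms x by blast
    then have "((\<lambda>x. norm (\<rho> x)) \<longlongrightarrow> 0) (at x within S)" using tendsto_norm[OF \<rho>] by simp
    then have "((\<lambda>x. \<rho> x *\<^sub>R sgn (\<zeta> x)) \<longlongrightarrow> 0) (at x within S)"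
      by (rule Lim_null_comparison[rotated]) (auto simp: norm_sgn intro!: always_eventually)
    then show ?thesis using \<open>\<rho> x = 0\<close> by simp
  next
    case False
    then show ?thesis using \<rho> \<zeta> by (intro tendsto_intros)
  qed
qed

text \<open>Contract the point of \<open>S\<close> nearest to \<open>x + \<xi>\<close> towards
  \<open>x\<close> by the same factor. Where positive, the distance therefore increases strictly
  along a ray from \<open>x\<close>.\<close>

lemma infdist_along_ray:
  fixes S :: "'a::euclidean_space set"
  assumes "convex S" "closed S" "x \<in> S" "0 \<le> c" "c \<le> 1"
  shows "infdist (x + c *\<^sub>R \<xi>) S \<le> c * infdist (x + \<xi>) S"
proof -
  obtain y where y: "y \<in> S" "infdist (x + \<xi>) S = dist (x + \<xi>) y"
    using infdist_attains_inf[of S "x + \<xi>"] assms by auto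
  have "(1 - c) *\<^sub>R x + c *\<^sub>R y \<in> S" using assms y by (simp add: convexD)
  then have "infdist (x + c *\<^sub>R \<xi>) S \<le> dist (x + c *\<^sub>R \<xi>) ((1 - c) *\<^sub>R x + c *\<^sub>R y)"
    by (rule infdist_le)
  also have "(x + c *\<^sub>R \<xi>) - ((1 - c) *\<^sub>R x + c *\<^sub>R y) = c *\<^sub>R ((x + \<xi>) - y)"
    by (simp add: algebra_simps)
  then have "dist (x + c *\<^sub>R \<xi>) ((1 - c) *\<^sub>R x + c *\<^sub>R y) = c * dist (x + \<xi>) y"
    using assms by (simp add: dist_norm)
  finally show ?thesis using y by simp
qed

context thick_polygon
begin

section \<open>The tube as the union of the cells\<close>

lemma UN_mod:
  assumes "\<And>k. B (k mod n) = B k"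
  shows "(\<Union>k. B k) = (\<Union>k\<in>{0..<n}. B k)"
proof -
  have "B k \<subseteq> (\<Union>k\<in>{0..<n}. B k)" for k
    using assms[of k] UN_upper[of "k mod n" "{0..<n}" B] n3 by simp
  then show ?thesis by blast
qed

lemma K_eq: "K = (\<Union>k\<in>{0..<n}. E k)"
  unfolding K_def by (rule UN_mod) (rule E_mod)

lemma compact_K: "compact K"
  unfolding K_eq by (intro compact_UN) auto

lemma K_nonempty: "K \<noteq> {}"
  using V_in_E(1)[of 0] by (auto simp: K_def)

lemma C_meet:
  assumes "p \<in> C j" "p \<in> C k"
  obtains m d where "k = j + d + m * n" "d \<in> {-1, 0, 1}" "p \<in> C (j + d)" "E k = E (j + d)"
proof -
  have "adj n k j" using cells_disjoint[of k j] assms by blast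
  then obtain m d where "k = j + d + m * n" "d \<in> {-1, 0, 1}" by (rule adj_cases)
  then show ?thesis using that assms by (simp add: shift)
qed

lemma E_meet:
  assumes "x \<in> E j" "x \<in> E k"
  obtains m d where "k = j + d + m * n" "d = 0 \<or> d = 1 \<and> x = V (j + 1) \<or> d = -1 \<and> x = V j"
proof -
  have "adj n k j" using disj[of k j] assms by blast
  then obtain m d where *: "k = j + d + m * n" "d \<in> {-1, 0, 1}" by (rule adj_cases)
  then have "x \<in> E (j + d)" using assms by (simp add: shift)
  then have "d = 0 \<or> d = 1 \<and> x = V (j + 1) \<or> d = -1 \<and> x = V j"
    using *(2) assms meet[of j] meet[of "j - 1"] by auto
  with * show ?thesis using that by blast
qed

text \<open>A nearest point of \<open>K\<close> lies on some \<open>E j\<close> with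
  \<open>p\<close> in \<open>C j\<close>, and \<open>j\<close> is equal or adjacent to
  \<open>k\<close> modulo \<open>n\<close>. In the adjacent case \<open>p\<close> lies on the common
  bisecting plane, so mirroring the nearest point gives an equally near point of
  \<open>E k\<close>.\<close>

lemma infdist_K:
  assumes p: "p \<in> C k"
  shows "infdist p K = infdist p (E k)"
proof (rule antisym)
  show le: "infdist p K \<le> infdist p (E k)"
    using E_subset_K by (intro infdist_mono) auto
  obtain x where x: "x \<in> K" "infdist p K = dist p x"
    using infdist_attains_inf[OF compact_imp_closed[OF compact_K] K_nonempty] .
  have near: "\<forall>z\<in>K. dist p x \<le> dist p z" using x(2) infdist_le[of _ K p] by auto
  have r: "dist p x \<le> r" using le x(2) p by (simp add: C_iff)
  obtain j where j: "x \<in> E j" "p \<in> C j" by (rule nearest_cell[OF x(1) near r])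
  have nearE: "\<forall>z\<in>E j. dist p x \<le> dist p z" using near E_subset_K by blast
  obtain m d where d: "k = j + d + m * n" "d \<in> {-1, 0, 1}" "p \<in> C (j + d)" "E k = E (j + d)"
    by (rule C_meet[OF j(2) p])
  have "\<exists>x'\<in>E k. dist p x' = dist p x"
  proof -
    consider "d = 0" | "d = 1" | "d = -1" using d by blast
    then show ?thesis
    proof cases
      case 1
      then show ?thesis using d j by auto
    next
      case 2
      then have A0: "A (j + 1) p = 0" using j d by (auto simp: C_def)
      then have "0 \<le> A (j + 1) p" by simp
      then obtain x' s where x': "x' \<in> E (j + 1)" "0 \<le> s" "x = V (j + 1) \<or> 0 < s"
        "\<forall>q. (dist q x')\<^sup>2 - (dist q x)\<^sup>2 = - s * A (j + 1) q"
        by (rule reflect_forth[OF j(1) nearE r])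
      have "(dist p x')\<^sup>2 = (dist p x)\<^sup>2" using x'(4)[rule_format, of p] A0 by simp
      then show ?thesis using x'(1) d 2 by auto
    next
      case 3
      then have A0: "A j p = 0" using j d by (auto simp: C_def)
      then have "A j p \<le> 0" by simp
      then obtain x' s where x': "x' \<in> E (j - 1)" "0 \<le> s" "x = V j \<or> 0 < s"
        "\<forall>q. (dist q x')\<^sup>2 - (dist q x)\<^sup>2 = s * A j q"
        by (rule reflect_back[OF j(1) nearE r])
      have "(dist p x')\<^sup>2 = (dist p x)\<^sup>2" using x'(4)[rule_format, of p] A0 by simp
      then show ?thesis using x'(1) d 3 by auto
    qed
  qed
  then show "infdist p (E k) \<le> infdist p K" using x(2) infdist_le[of _ "E k" p] by fastforce
qed

definition T :: "pt set" where
  "T = (\<Union>k. C k)"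

lemma T_eq: "T = (\<Union>k\<in>{0..<n}. C k)"
  unfolding T_def by (rule UN_mod) (rule C_mod)

lemma compact_T: "compact T"
  unfolding T_eq by (intro compact_UN) (auto intro: compact_C)

lemma T_iff: "p \<in> T \<longleftrightarrow> infdist p K \<le> r"
proof
  assume "p \<in> T"
  then show "infdist p K \<le> r" using infdist_K by (auto simp: T_def C_iff)
next
  assume r: "infdist p K \<le> r"
  obtain x where x: "x \<in> K" "infdist p K = dist p x"
    using infdist_attains_inf[OF compact_imp_closed[OF compact_K] K_nonempty] .
  have near: "\<forall>z\<in>K. dist p x \<le> dist p z" using x(2) infdist_le[of _ K p] by auto
  have "dist p x \<le> r" using r x(2) by simp
  then obtain j where "x \<in> E j" "p \<in> C j" by (rule nearest_cell[OF x(1) near])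
  then show "p \<in> T" by (auto simp: T_def)
qed

text \<open>The cell of an edge is sliced by the planes through the points of the edge whose normals
  interpolate linearly between the normals of the two bisecting planes; \<open>slice k p\<close> is the position
  of the slice that contains \<open>p\<close>.\<close>

definition slice :: "int \<Rightarrow> pt \<Rightarrow> real" where
  "slice k p = A k p / (A k p - A (k + 1) p)"

text \<open>The point where the slice containing \<open>p\<close> cuts the edge. On a bisecting
  plane shared by two cells both formulas give the vertex, so any choice of cell serves
  (\<open>proj_eq\<close>).\<close>

definition proj :: "pt \<Rightarrow> pt" where
  "proj p = (let k = SOME k. p \<in> C k in V k + (slice k p * L k) *\<^sub>R U k)"

text \<open>The quotient is the position of \<open>x\<close> on the edge, from 0 to 1; at a common
  vertex either edge gives the normal of the bisecting plane (\<open>normal_eq\<close>).\<close>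

definition normal :: "pt \<Rightarrow> pt" where
  "normal x = (let k = SOME k. x \<in> E k in N k + ((x - V k) \<bullet> U k / L k) *\<^sub>R (N (k + 1) - N k))"

lemma proj_eq:
  assumes p: "p \<in> C k"
  shows "proj p = V k + (slice k p * L k) *\<^sub>R U k"
proof -
  define j where "j = (SOME k. p \<in> C k)"
  have j: "p \<in> C j" unfolding j_def using p by (rule someI)
  have step: "V i + (slice i p * L i) *\<^sub>R U i = V (i + 1) + (slice (i + 1) p * L (i + 1)) *\<^sub>R U (i + 1)"
    if "p \<in> C i" "p \<in> C (i + 1)" for i
  proof -
    have "A (i + 1) p = 0" using that by (auto simp: C_def)
    moreover have "A i p \<noteq> 0" using C_A[OF that(1)] calculation by simp
    ultimately show ?thesis by (simp add: slice_def V_Suc)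
  qed
  obtain m d where d: "k = j + d + m * n" "d \<in> {-1, 0, 1}" "p \<in> C (j + d)" "E k = E (j + d)"
    by (rule C_meet[OF j p])
  have s1: "A (i + m * n + 1) p = A (i + 1) p" for i using shift(5)[of "i + 1" m p] by (simp add: ac_simps)
  have "V k + (slice k p * L k) *\<^sub>R U k = V (j + d) + (slice (j + d) p * L (j + d)) *\<^sub>R U (j + d)"
    unfolding d(1) slice_def by (simp add: shift V_shift s1)
  also have "\<dots> = V j + (slice j p * L j) *\<^sub>R U j"
    using d(2,3) j step[of j] step[of "j - 1"] by auto
  finally show ?thesis by (simp add: proj_def Let_def j_def)
qed

lemma normal_eq:
  assumes x: "x \<in> E k"
  shows "normal x = N k + ((x - V k) \<bullet> U k / L k) *\<^sub>R (N (k + 1) - N k)"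
proof -
  define j where "j = (SOME k. x \<in> E k)"
  have j: "x \<in> E j" unfolding j_def using x by (rule someI)
  have step: "N i + ((V (i + 1) - V i) \<bullet> U i / L i) *\<^sub>R (N (i + 1) - N i) = N (i + 1)" for i
    using L_pos[of i] by (simp add: V_Suc)
  obtain m d where d: "k = j + d + m * n" "d = 0 \<or> d = 1 \<and> x = V (j + 1) \<or> d = -1 \<and> x = V j"
    by (rule E_meet[OF j x])
  have s1: "N (i + m * n + 1) = N (i + 1)" for i using shift(4)[of "i + 1" m] by (simp add: ac_simps)
  have "N k + ((x - V k) \<bullet> U k / L k) *\<^sub>R (N (k + 1) - N k) =
     N (j + d) + ((x - V (j + d)) \<bullet> U (j + d) / L (j + d)) *\<^sub>R (N (j + d + 1) - N (j + d))"
    unfolding d(1) by (simp add: shift V_shift s1)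
  also have "\<dots> = N j + ((x - V j) \<bullet> U j / L j) *\<^sub>R (N (j + 1) - N j)"
    using d(2) step[of j] step[of "j - 1"] by auto
  finally show ?thesis by (simp add: normal_def Let_def j_def)
qed

lemma continuous_on_proj: "continuous_on T proj"
  unfolding T_eq
proof (rule continuous_on_closed_Union)
  show "continuous_on (C k) proj" for k
  proof -
    have "continuous_on (C k) (\<lambda>p. V k + (slice k p * L k) *\<^sub>R U k)"
      unfolding slice_def by (intro continuous_intros) (use C_A in force)
    then show ?thesis by (rule continuous_on_eq) (simp add: proj_eq)
  qed
qed (auto intro: compact_imp_closed compact_C)

lemma continuous_on_normal: "continuous_on K normal"
  unfolding K_eq
proof (rule continuous_on_closed_Union)
  show "continuous_on (E k) normal" for k
  proof -
    have "continuous_on (E k) (\<lambda>x. N k + ((x - V k) \<bullet> U k / L k) *\<^sub>R (N (k + 1) - N k))"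
      using L_pos[of k] by (intro continuous_intros) auto
    then show ?thesis by (rule continuous_on_eq) (simp add: normal_eq)
  qed
qed auto

lemma slice_bounds: "p \<in> C k \<Longrightarrow> 0 \<le> slice k p \<and> slice k p \<le> 1"
  using C_A[of p k] by (auto simp: slice_def C_def divide_simps)

lemma proj_in_E: "p \<in> C k \<Longrightarrow> proj p \<in> E k"
  using slice_bounds[of p k] L_pos[of k] E_iff[of "proj p" k] proj_eq[of p k] by auto

lemma proj_in_K: "p \<in> T \<Longrightarrow> proj p \<in> K"
  using proj_in_E E_subset_K by (auto simp: T_def)

text \<open>Shifting the base point from the vertices to \<open>x\<close> contributes
  \<open>- (1 - t) * t * L k\<close> and \<open>t * (1 - t) * L k\<close>, which cancel. That the
  right side vanishes is the equation solved by \<open>t = slice k p\<close>.\<close>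

lemma normal_at:
  assumes "x = V k + (t * L k) *\<^sub>R U k" "0 \<le> t" "t \<le> 1"
  shows "(p - x) \<bullet> normal x = (1 - t) * A k p + t * A (k + 1) p"
proof -
  have x: "x \<in> E k" using assms E_iff[of x k] L_pos[of k] by auto
  have "normal x = N k + t *\<^sub>R (N (k + 1) - N k)"
    using normal_eq[OF x] L_pos[of k] by (simp add: assms(1))
  then have "(p - x) \<bullet> normal x = (1 - t) * ((p - x) \<bullet> N k) + t * ((p - x) \<bullet> N (k + 1))"
    by (simp only: inner_add_right inner_diff_right inner_scaleR_right) (simp add: left_diff_distrib right_diff_distrib)
  moreover have "(p - x) \<bullet> N k = A k p - t * L k"
    by (simp add: A_def assms(1) inner_diff_left inner_add_left)
  moreover have "(p - x) \<bullet> N (k + 1) = A (k + 1) p + (1 - t) * L k"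
    by (simp add: A_def assms(1) V_Suc inner_diff_left inner_add_left left_diff_distrib)
  ultimately have "(p - x) \<bullet> normal x = (1 - t) * (A k p - t * L k) + t * (A (k + 1) p + (1 - t) * L k)"
    by (simp only:)
  also have "\<dots> = (1 - t) * A k p + t * A (k + 1) p" by algebra
  finally show ?thesis .
qed

lemma proj_normal:
  assumes "p \<in> T"
  shows "(p - proj p) \<bullet> normal (proj p) = 0"
proof -
  obtain k where p: "p \<in> C k" using assms by (auto simp: T_def)
  have "(1 - slice k p) * A k p + slice k p * A (k + 1) p = 0"
    using C_A[OF p] by (simp add: slice_def field_simps)
  then show ?thesis using normal_at[OF proj_eq[OF p]] slice_bounds[OF p] by simp
qed

text \<open>As \<open>A (k + 1) p < A k p\<close>, a vanishing convex combination of the two forces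
  the signs that define the cell, and its weight is \<open>slice k p\<close>.\<close>

lemma proj_unique:
  assumes x: "x \<in> E k" and p: "infdist p (E k) \<le> r" "(p - x) \<bullet> normal x = 0"
  shows "p \<in> C k" "proj p = x"
proof -
  obtain s where s: "0 \<le> s" "s \<le> L k" "x = V k + s *\<^sub>R U k" using x E_iff by blast
  define t where "t = s / L k"
  have t: "0 \<le> t" "t \<le> 1" "x = V k + (t * L k) *\<^sub>R U k" using s L_pos[of k] by (auto simp: t_def)
  obtain y where "y \<in> E k" "infdist p (E k) = dist p y" by (rule nearest_E)
  then have lt: "A (k + 1) p < A k p" using A_strict_anti p by simp
  have 0: "(1 - t) * A k p + t * A (k + 1) p = 0" using normal_at[OF t(3,1,2)] p by simp
  then have Ak: "A k p = t * (A k p - A (k + 1) p)" and Ak1: "A (k + 1) p = - ((1 - t) * (A k p - A (k + 1) p))"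
    by (simp_all add: algebra_simps)
  have "0 \<le> t * (A k p - A (k + 1) p)" "0 \<le> (1 - t) * (A k p - A (k + 1) p)"
    using t lt by simp_all
  then have "0 \<le> A k p" "A (k + 1) p \<le> 0" using Ak Ak1 by linarith+
  then show pC: "p \<in> C k" using p by (simp add: C_iff)
  have "slice k p = t" using Ak lt by (simp add: slice_def field_simps)
  then show "proj p = x" using proj_eq[OF pC] t by simp
qed

lemma proj_K: "x \<in> K \<Longrightarrow> x \<in> T \<and> proj x = x"
  using proj_unique[of x _ x] r_pos by (fastforce simp: K_def T_def)

text \<open>Projecting to an end of an edge means slice position 0 or 1, so the point lies in a
  bisecting plane and in the cells on both sides of it.\<close>

lemma proj_cell:
  assumes p: "p \<in> T" "proj p \<in> E k"
  shows "p \<in> C k"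
proof -
  obtain j where j: "p \<in> C j" using p by (auto simp: T_def)
  obtain m d where d: "k = j + d + m * n" "d = 0 \<or> d = 1 \<and> proj p = V (j + 1) \<or> d = -1 \<and> proj p = V j"
    by (rule E_meet[OF proj_in_E[OF j] p(2)])
  have "p \<in> C (j + d)"
    using d(2)
  proof (elim disjE conjE)
    assume d1: "d = 1" "proj p = V (j + 1)"
    then have "slice j p = 1" using proj_eq[OF j] L_pos[of j] by (simp add: V_Suc)
    then have "A (j + 1) p = 0" using C_A[OF j] by (simp add: slice_def)
    then show ?thesis using C_forth j d1 by simp
  next
    assume d1: "d = -1" "proj p = V j"
    then have "slice j p = 0" using proj_eq[OF j] L_pos[of j] by simp
    then have "A j p = 0" using C_A[OF j] by (simp add: slice_def)
    then show ?thesis using C_back j d1 by simp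
  qed (use j in simp)
  then show ?thesis using d by (simp add: shift)
qed

section \<open>Trivialising the disc bundle\<close>

lemma normal_nonzero_span:
  assumes "x \<in> E k"
  shows "normal x \<noteq> 0" "normal x \<in> span {N k, N (k + 1)}"
proof -
  have "normal x \<bullet> U k = 1"
    using normal_eq[OF assms] by (simp add: inner_add_left inner_diff_left)
  then show "normal x \<noteq> 0" by auto
  show "normal x \<in> span {N k, N (k + 1)}"
    unfolding normal_eq[OF assms] by (intro span_add span_scale span_diff span_base) auto
qed

text \<open>The normals along an edge stay in a span of dimension at most 2. Finitely many such
  spans have measure zero, and a \<open>w\<close> outside all of them is parallel to no
  normal.\<close>

lemma transversal_vector:
  obtains w where "\<And>x. x \<in> K \<Longrightarrow> cross3 w (normal x) \<noteq> 0"
proof -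
  have "negligible (\<Union>k\<in>{0..<n}. span {N k, N (k + 1)})"
  proof (intro negligible_Union ballI, goal_cases)
    case 1 show ?case by simp
  next
    case (2 S)
    then obtain k where S: "S = span {N k, N (k + 1)}" by blast
    have "dim {N k, N (k + 1)} \<le> card {N k, N (k + 1)}" by (rule dim_le_card') simp
    also have "\<dots> \<le> 2" by (simp add: card_insert_if)
    finally show ?case unfolding S by (intro negligible_lowdim) simp
  qed
  then have "(\<Union>k\<in>{0..<n}. span {N k, N (k + 1)}) \<noteq> UNIV"
    using non_negligible_UNIV by metis
  then obtain w where w: "\<And>k. k \<in> {0..<n} \<Longrightarrow> w \<notin> span {N k, N (k + 1)}" by blast
  show ?thesis
  proof (rule that[of w], rule notI)
    fix x assume "x \<in> K" "cross3 w (normal x) = 0"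
    then obtain k where k: "k \<in> {0..<n}" "x \<in> E k" by (auto simp: K_eq)
    have "w \<noteq> 0" using w[OF k(1)] span_zero by metis
    then obtain c where c: "normal x = c *\<^sub>R w"
      using \<open>cross3 w (normal x) = 0\<close> normal_nonzero_span(1)[OF k(2)]
      by (auto simp: cross_eq_0 collinear_lemma)
    then have "c \<noteq> 0" using normal_nonzero_span(1)[OF k(2)] by auto
    then have "w = inverse c *\<^sub>R normal x" using c by simp
    then show False using w[OF k(1)] normal_nonzero_span(2)[OF k(2)] span_scale by metis
  qed
qed

lemma solid_torus:
  "\<exists>F G. homeomorphism T (K \<times> cball (0::complex) 1) F G \<and> F ` K = K \<times> {0}"
proof -
  obtain w where w: "\<And>x. x \<in> K \<Longrightarrow> cross3 w (normal x) \<noteq> 0"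
    by (rule transversal_vector) blast
  define e where "e x = cross3 w (normal x)" for x
  define f where "f x = cross3 (normal x) (e x)" for x
  define \<zeta> where "\<zeta> p = Complex ((p - proj p) \<bullet> e (proj p)) ((p - proj p) \<bullet> f (proj p))" for p
  \<comment> \<open>Polar coordinates in each slice: the angle comes from the frame
    \<open>e\<close>, \<open>f\<close>, and the radius is the distance to the knot divided by
    \<open>r\<close>, so points at distance \<open>r\<close> go to the unit circle.\<close>
  define F where "F p = (proj p, (infdist p K / r) *\<^sub>R sgn (\<zeta> p))" for p
  have \<zeta>0: "p = proj p" if "p \<in> T" "\<zeta> p = 0" for p
  proof -
    have "p - proj p = 0"
      using frame_eq_0[OF w[OF proj_in_K[OF that(1)]], of "p - proj p"] that proj_normal[OF that(1)]
      by (auto simp: \<zeta>_def e_def f_def complex_eq_iff)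
    then show ?thesis by simp
  qed
  have cont_e: "continuous_on K e" unfolding e_def
    by (intro continuous_on_cross continuous_on_const continuous_on_normal)
  have cont_f: "continuous_on K f" unfolding f_def
    by (intro continuous_on_cross continuous_on_normal cont_e)
  have sub: "proj ` T \<subseteq> K" using proj_in_K by blast
  have cont_\<zeta>: "continuous_on T \<zeta>"
    unfolding \<zeta>_def Complex_eq
    by (intro continuous_intros continuous_on_proj
        continuous_on_compose2[OF cont_e continuous_on_proj sub]
        continuous_on_compose2[OF cont_f continuous_on_proj sub])
  have \<rho>0: "infdist p K / r = 0" if "p \<in> T" "\<zeta> p = 0" for p
    using \<zeta>0[OF that] proj_in_K[OF that(1)] by simp
  have cont: "continuous_on T F"
    unfolding F_def using r_pos
    by (intro continuous_on_Pair continuous_on_proj continuous_on_scaleR_sgn cont_\<zeta> \<rho>0)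
       (auto intro!: continuous_intros)
  have inj: "inj_on F T"
  proof (rule inj_onI)
    fix p q assume p: "p \<in> T" and q: "q \<in> T" and eq: "F p = F q"
    define x where "x = proj p"
    have xq: "proj q = x" and eq2: "(infdist p K / r) *\<^sub>R sgn (\<zeta> p) = (infdist q K / r) *\<^sub>R sgn (\<zeta> q)"
      using eq by (auto simp: F_def x_def)
    obtain k where k: "x \<in> E k" using proj_in_K[OF p] by (auto simp: x_def K_def)
    have pk: "p \<in> C k" and qk: "q \<in> C k" using proj_cell k p q xq by (auto simp: x_def)
    have onK: "p' = proj p'" if "p' \<in> T" "infdist p' K = 0" for p'
    proof -
      have "p' \<in> K"
        using in_closed_iff_infdist_zero[OF compact_imp_closed[OF compact_K] K_nonempty] that by simp
      then show ?thesis using proj_K by simp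
    qed
    have norm_eq: "norm ((infdist p' K / r) *\<^sub>R sgn (\<zeta> p')) = infdist p' K / r" if "p' \<in> T" for p'
      using \<rho>0[OF that] r_pos by (cases "\<zeta> p' = 0") (auto simp: norm_sgn infdist_nonneg)
    have d: "infdist p K = infdist q K"
      using norm_eq[OF p] norm_eq[OF q] eq2 r_pos by simp
    show "p = q"
    proof (cases "infdist p K = 0")
      case True
      then show ?thesis using onK[OF p] onK[OF q] d xq x_def by simp
    next
      case False
      then have pos: "0 < infdist p K" using infdist_nonneg[of p K] by simp
      have nz: "\<zeta> p \<noteq> 0" "\<zeta> q \<noteq> 0" using \<rho>0[of p] \<rho>0[of q] p q d False r_pos by auto
      have sg: "sgn (\<zeta> p) = sgn (\<zeta> q)" using eq2 d pos r_pos by simp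
      define c where "c = norm (\<zeta> q) / norm (\<zeta> p)"
      have c: "0 < c" "\<zeta> q = c *\<^sub>R \<zeta> p"
      proof -
        show "0 < c" using nz by (simp add: c_def)
        have "\<zeta> q = norm (\<zeta> q) *\<^sub>R sgn (\<zeta> q)" using nz by (simp add: sgn_div_norm)
        also have "\<dots> = c *\<^sub>R \<zeta> p" unfolding sg[symmetric] by (simp add: sgn_div_norm c_def divide_inverse)
        finally show "\<zeta> q = c *\<^sub>R \<zeta> p" .
      qed
      \<comment> \<open>Both vectors lie in the same slice with proportional frame coordinates, so
        \<open>p\<close> and \<open>q\<close> are on one ray from \<open>x\<close>.\<close>
      have "(q - x) - c *\<^sub>R (p - x) = 0"
      proof (rule frame_eq_0[OF w[of x]])
        show "x \<in> K" using k E_subset_K by blast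
        show "(q - x - c *\<^sub>R (p - x)) \<bullet> normal x = 0"
          using proj_normal[OF p, folded x_def] proj_normal[OF q, unfolded xq]
          by (simp add: inner_diff_left[of "q - x"])
        have "\<zeta> p = Complex ((p - x) \<bullet> e x) ((p - x) \<bullet> f x)" by (simp add: \<zeta>_def x_def)
        moreover have "\<zeta> q = Complex ((q - x) \<bullet> e x) ((q - x) \<bullet> f x)" by (simp add: \<zeta>_def xq)
        ultimately have "(q - x) \<bullet> e x = c * ((p - x) \<bullet> e x)" "(q - x) \<bullet> f x = c * ((p - x) \<bullet> f x)"
          using c(2) by (simp_all add: complex_eq_iff)
        then show "(q - x - c *\<^sub>R (p - x)) \<bullet> cross3 w (normal x) = 0"
          "(q - x - c *\<^sub>R (p - x)) \<bullet> cross3 (normal x) (cross3 w (normal x)) = 0"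
          by (simp_all add: inner_diff_left[of "q - x"] e_def f_def)
      qed
      then have qx: "q - x = c *\<^sub>R (p - x)" by simp
      \<comment> \<open>Equal positive distances to the edge exclude a contraction along the ray. It
        is applied to \<open>c\<close> or to its inverse, whichever is at most 1.\<close>
      have ray: "c' = 1" if c': "0 < c'" "c' \<le> 1" "b - x = c' *\<^sub>R (a - x)"
        and ab: "infdist a (E k) = infdist b (E k)" "0 < infdist a (E k)" for a b c'
      proof (rule ccontr)
        assume "c' \<noteq> 1"
        have "b = x + c' *\<^sub>R (a - x)" using c' by (simp add: algebra_simps)
        then have "infdist b (E k) \<le> c' * infdist a (E k)"
          using infdist_along_ray[OF convex_E closed_E k, of c' "a - x"] c' by simp
        also have "\<dots> < infdist a (E k)" using c' \<open>c' \<noteq> 1\<close> ab by simp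
        finally show False using ab by simp
      qed
      have dE: "infdist p (E k) = infdist q (E k)" "0 < infdist p (E k)"
        using d pos infdist_K[OF pk] infdist_K[OF qk] by auto
      have "c = 1"
      proof (cases "c \<le> 1")
        case True
        show ?thesis by (rule ray[OF c(1) True qx dE])
      next
        case False
        have "p - x = inverse c *\<^sub>R (q - x)" using qx c by simp
        then have "inverse c = 1" using False dE by (intro ray[of _ p q]) (auto simp: inverse_le_1_iff)
        then show ?thesis by simp
      qed
      then show ?thesis using qx by simp
    qed
  qed
  have img_sub: "F ` T \<subseteq> K \<times> cball 0 1"
  proof
    fix y assume "y \<in> F ` T"
    then obtain p where p: "p \<in> T" "y = F p" by blast
    have "norm ((infdist p K / r) *\<^sub>R sgn (\<zeta> p)) \<le> infdist p K / r"
      using r_pos by (auto simp: norm_sgn infdist_nonneg)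
    also have "\<dots> \<le> 1" using p T_iff r_pos by simp
    finally show "y \<in> K \<times> cball 0 1" using p proj_in_K by (auto simp: F_def)
  qed
  have F_K: "F x = (x, 0)" if "x \<in> K" for x
    using proj_K[OF that] that by (simp add: F_def)
  have surj: "(x, z) \<in> F ` T" if x: "x \<in> K" and z: "norm z \<le> 1" for x z
  proof (cases "z = 0")
    case True
    then show ?thesis using F_K[OF x] proj_K[OF x] by (metis image_eqI)
  next
    case False
    obtain k where k: "x \<in> E k" using x by (auto simp: K_def)
    obtain \<xi> where \<xi>: "\<xi> \<bullet> normal x = 0" "\<xi> \<bullet> e x = Re z" "\<xi> \<bullet> f x = Im z"
      using frame_solve[OF w[OF x]] unfolding e_def f_def by blast
    have "\<xi> \<noteq> 0" using False \<xi> by (auto simp: complex_eq_iff)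
    define g where "g s = infdist (x + s *\<^sub>R \<xi>) (E k)" for s
    \<comment> \<open>At parameter \<open>(r + L k) / norm \<xi>\<close> the point is
      \<open>r + L k\<close> away from \<open>x\<close>, while all of the edge is within
      \<open>L k\<close> of \<open>x\<close>; so its distance to the edge is at least
      \<open>r\<close>.\<close>
    have "\<exists>s. 0 \<le> s \<and> s \<le> (r + L k) / norm \<xi> \<and> g s = r * norm z"
    proof (rule IVT')
      show "g 0 \<le> r * norm z" using k r_pos by (simp add: g_def)
      obtain y where y: "y \<in> E k"
          "infdist (x + ((r + L k) / norm \<xi>) *\<^sub>R \<xi>) (E k) = dist (x + ((r + L k) / norm \<xi>) *\<^sub>R \<xi>) y"
        by (rule infdist_attains_inf[OF closed_E E_nonempty])
      have "dist x y \<le> L k"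
      proof -
        obtain a where "0 \<le> a" "a \<le> L k" "x = V k + a *\<^sub>R U k" using k E_iff by blast
        moreover obtain b where "0 \<le> b" "b \<le> L k" "y = V k + b *\<^sub>R U k" using y(1) E_iff by blast
        moreover have "norm (a *\<^sub>R U k - b *\<^sub>R U k) = \<bar>a - b\<bar>"
          by (simp flip: scaleR_left_diff_distrib)
        ultimately show ?thesis by (simp add: dist_norm)
      qed
      moreover have "dist (x + ((r + L k) / norm \<xi>) *\<^sub>R \<xi>) x = r + L k"
        using \<open>\<xi> \<noteq> 0\<close> r_pos L_pos[of k] by (simp add: dist_norm)
      ultimately have "r \<le> g ((r + L k) / norm \<xi>)"
        using dist_triangle[of "x + ((r + L k) / norm \<xi>) *\<^sub>R \<xi>" x y] y(2) dist_commute[of x y] by (simp add: g_def)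
      moreover have "r * norm z \<le> r" using z r_pos by simp
      ultimately show "r * norm z \<le> g ((r + L k) / norm \<xi>)" by simp
      show "0 \<le> (r + L k) / norm \<xi>" using r_pos L_pos[of k] by simp
      show "continuous_on {0..(r + L k) / norm \<xi>} g" unfolding g_def by (intro continuous_intros)
    qed
    then obtain s where s: "0 \<le> s" "g s = r * norm z" by blast
    define p where "p = x + s *\<^sub>R \<xi>"
    have "s \<noteq> 0"
    proof
      assume "s = 0"
      then have "g s = 0" using k by (simp add: g_def)
      then show False using s(2) False r_pos by simp
    qed
    have "infdist p (E k) \<le> r" using s(2) z r_pos by (simp add: p_def g_def)
    moreover have "(p - x) \<bullet> normal x = 0" using \<xi> by (simp add: p_def)
    ultimately have p: "p \<in> C k" "proj p = x" using proj_unique[OF k] by auto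
    have "infdist p K = r * norm z" using infdist_K[OF p(1)] s(2) by (simp add: p_def g_def)
    moreover have "\<zeta> p = s *\<^sub>R z"
      unfolding \<zeta>_def p(2) using \<xi> by (simp add: p_def complex_eq_iff)
    then have "sgn (\<zeta> p) = sgn z" using s(1) \<open>s \<noteq> 0\<close> by (simp add: sgn_scaleR)
    ultimately have "F p = (x, norm z *\<^sub>R sgn z)" using p r_pos by (simp add: F_def)
    then have "F p = (x, z)" using False by (simp add: sgn_div_norm)
    moreover have "p \<in> T" using p by (auto simp: T_def)
    ultimately show ?thesis by (metis image_eqI)
  qed
  have "F ` T = K \<times> cball 0 1" using img_sub surj by auto
  then obtain G where "homeomorphism T (K \<times> cball 0 1) F G"
    using homeomorphism_compact[OF compact_T cont _ inj] by blast
  moreover have "F ` K = K \<times> {0}" using F_K by force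
  ultimately show ?thesis by blast
qed

end

section \<open>The core is a circle\<close>

definition ppath :: "(int \<Rightarrow> pt) \<Rightarrow> real \<Rightarrow> pt" where
  "ppath V t = V \<lfloor>t\<rfloor> + frac t *\<^sub>R (V (\<lfloor>t\<rfloor> + 1) - V \<lfloor>t\<rfloor>)"

text \<open>At the right end the floor has already moved on to \<open>k + 1\<close>, but both
  formulas give \<open>V (k + 1)\<close> there.\<close>

lemma ppath_on:
  assumes "of_int k \<le> t" "t \<le> of_int k + 1"
  shows "ppath V t = V k + (t - of_int k) *\<^sub>R (V (k + 1) - V k)"
proof (cases "t = of_int k + 1")
  case True
  then have "\<lfloor>t\<rfloor> = k + 1" "frac t = 0" by (auto simp: frac_def)
  then show ?thesis using True by (simp add: ppath_def)
next
  case False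
  then have "\<lfloor>t\<rfloor> = k" using assms by linarith
  then show ?thesis by (simp add: ppath_def frac_def)
qed

section \<open>Turning points of the distance along the polygon\<close>

lemma dist_strict_mono_on_ray:
  fixes y x d :: "'a::real_inner"
  assumes "(y - x) \<bullet> d \<le> 0" "d \<noteq> 0" "0 \<le> a" "a < b"
  shows "dist y (x + a *\<^sub>R d) < dist y (x + b *\<^sub>R d)"
proof -
  have "a\<^sup>2 * (d \<bullet> d) < b\<^sup>2 * (d \<bullet> d)"
    using assms by (intro mult_strict_right_mono power_strict_mono) auto
  moreover have "b * ((y - x) \<bullet> d) \<le> a * ((y - x) \<bullet> d)"
    using assms by (simp add: mult_right_mono_neg)
  ultimately have "(dist y (x + a *\<^sub>R d))\<^sup>2 < (dist y (x + b *\<^sub>R d))\<^sup>2"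
    by (simp add: dist_ray_sq)
  then show ?thesis by (rule power2_less_imp_less) simp
qed

text \<open>The path leaves \<open>x\<close> along one ray forwards and one backwards, neither at an
  acute angle to \<open>y - x\<close>. Along such rays the distance strictly increases, by the
  quadratic term even where the linear one vanishes.\<close>

lemma locmin_turning:
  assumes neq: "\<And>k. V k \<noteq> V (k + 1)" and "locmin V y x"
  shows "\<exists>t. ppath V t = x \<and> (\<exists>e>0.
      (\<forall>s1 s2. t - e \<le> s1 \<and> s1 < s2 \<and> s2 \<le> t \<longrightarrow> dist y (ppath V s1) > dist y (ppath V s2)) \<and>
      (\<forall>s1 s2. t \<le> s1 \<and> s1 < s2 \<and> s2 \<le> t + e \<longrightarrow> dist y (ppath V s1) < dist y (ppath V s2)))"
proof -
  have main: ?thesis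
    if e: "0 < e" and d: "d \<noteq> 0" "(y - x) \<bullet> d \<le> 0" and d': "d' \<noteq> 0" "(y - x) \<bullet> d' \<le> 0"
      and right: "\<And>s. t \<le> s \<Longrightarrow> s \<le> t + e \<Longrightarrow> ppath V s = x + (s - t) *\<^sub>R d"
      and left: "\<And>s. t - e \<le> s \<Longrightarrow> s \<le> t \<Longrightarrow> ppath V s = x + (t - s) *\<^sub>R d'" for t e d d'
  proof -
    have "ppath V t = x" using right[of t] e by simp
    moreover have "\<forall>s1 s2. t - e \<le> s1 \<and> s1 < s2 \<and> s2 \<le> t \<longrightarrow> dist y (ppath V s1) > dist y (ppath V s2)"
    proof (intro allI impI)
      fix s1 s2 assume "t - e \<le> s1 \<and> s1 < s2 \<and> s2 \<le> t"
      then show "dist y (ppath V s1) > dist y (ppath V s2)"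
        using left[of s1] left[of s2] dist_strict_mono_on_ray[OF d'(2,1), of "t - s2" "t - s1"] by simp
    qed
    moreover have "\<forall>s1 s2. t \<le> s1 \<and> s1 < s2 \<and> s2 \<le> t + e \<longrightarrow> dist y (ppath V s1) < dist y (ppath V s2)"
    proof (intro allI impI)
      fix s1 s2 assume "t \<le> s1 \<and> s1 < s2 \<and> s2 \<le> t + e"
      then show "dist y (ppath V s1) < dist y (ppath V s2)"
        using right[of s1] right[of s2] dist_strict_mono_on_ray[OF d(2,1), of "s1 - t" "s2 - t"] by simp
    qed
    ultimately show ?thesis using e by blast
  qed
  obtain k where "(x = V k \<and> (y - x) \<bullet> (V (k + 1) - V k) \<le> 0 \<and> (y - x) \<bullet> (V (k - 1) - V k) \<le> 0) \<or>
     (x \<in> open_segment (V k) (V (k + 1)) \<and> (y - x) \<bullet> (V (k + 1) - V k) = 0)"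
    using assms(2) unfolding locmin_def by blast
  then show ?thesis
  proof (elim disjE conjE)
    assume x: "x = V k" and d: "(y - x) \<bullet> (V (k + 1) - V k) \<le> 0" "(y - x) \<bullet> (V (k - 1) - V k) \<le> 0"
    show ?thesis
    proof (rule main[of 1 "V (k + 1) - V k" "V (k - 1) - V k" "of_int k"])
      show "V (k + 1) - V k \<noteq> 0" "V (k - 1) - V k \<noteq> 0" using neq[of k] neq[of "k - 1"] by auto
      show "ppath V s = x + (s - of_int k) *\<^sub>R (V (k + 1) - V k)" if "of_int k \<le> s" "s \<le> of_int k + 1" for s
        using ppath_on[OF that] x by simp
      show "ppath V s = x + (of_int k - s) *\<^sub>R (V (k - 1) - V k)" if "of_int k - 1 \<le> s" "s \<le> of_int k" for s
        using ppath_on[of "k - 1" s V] that x by (simp add: algebra_simps)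
    qed (use d in auto)
  next
    assume x: "x \<in> open_segment (V k) (V (k + 1))" and d: "(y - x) \<bullet> (V (k + 1) - V k) = 0"
    obtain \<tau> where \<tau>: "0 < \<tau>" "\<tau> < 1" "x = V k + \<tau> *\<^sub>R (V (k + 1) - V k)"
      using x by (auto simp: in_segment algebra_simps)
    define D where "D = V (k + 1) - V k"
    have on: "ppath V s = V k + (s - of_int k) *\<^sub>R D" if "of_int k \<le> s" "s \<le> of_int k + 1" for s
      using ppath_on[OF that] by (simp add: D_def)
    show ?thesis
    proof (rule main[of "min \<tau> (1 - \<tau>)" D "- D" "of_int k + \<tau>"])
      show "D \<noteq> 0" "- D \<noteq> 0" using neq[of k] by (auto simp: D_def)
      show "(y - x) \<bullet> D \<le> 0" "(y - x) \<bullet> - D \<le> 0" using d unfolding D_def[symmetric] by simp_all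
      show "ppath V s = x + (s - (of_int k + \<tau>)) *\<^sub>R D"
        if "of_int k + \<tau> \<le> s" "s \<le> of_int k + \<tau> + min \<tau> (1 - \<tau>)" for s
        using on[of s] that \<tau>(1,2) unfolding \<tau>(3) D_def[symmetric] by (simp add: algebra_simps)
      show "ppath V s = x + (of_int k + \<tau> - s) *\<^sub>R (- D)"
        if "of_int k + \<tau> - min \<tau> (1 - \<tau>) \<le> s" "s \<le> of_int k + \<tau>" for s
        using on[of s] that \<tau>(1,2) unfolding \<tau>(3) D_def[symmetric] by (simp add: algebra_simps)
    qed (use \<tau> in auto)
  qed
qed

context thick_polygon
begin

section \<open>The polygon as a simple closed curve\<close>

lemma ppath_in_E: "ppath V t \<in> E \<lfloor>t\<rfloor>"
proof -
  have "ppath V t = V \<lfloor>t\<rfloor> + (frac t * L \<lfloor>t\<rfloor>) *\<^sub>R U \<lfloor>t\<rfloor>" by (simp add: ppath_def V_Suc)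
  moreover have "frac t \<le> 1" using frac_lt_1[of t] by simp
  ultimately show ?thesis using E_iff[of "ppath V t" "\<lfloor>t\<rfloor>"] L_pos[of "\<lfloor>t\<rfloor>"] by auto
qed

text \<open>Neighbouring edges share only a vertex that ends one of them, and the path never takes
  the end vertex of the edge given by the floor. So the floors agree modulo \<open>n\<close>, hence
  agree in the given range.\<close>

lemma ppath_inj:
  assumes "0 \<le> s" "s < of_int n" "0 \<le> t" "t < of_int n" and eq: "ppath V s = ppath V t"
  shows "s = t"
proof -
  define x where "x = ppath V s"
  have ne: "ppath V t \<noteq> V (\<lfloor>t\<rfloor> + 1)" for t
  proof
    assume e: "ppath V t = V (\<lfloor>t\<rfloor> + 1)"
    define D where "D = V (\<lfloor>t\<rfloor> + 1) - V \<lfloor>t\<rfloor>"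
    have "V \<lfloor>t\<rfloor> + frac t *\<^sub>R D = V \<lfloor>t\<rfloor> + 1 *\<^sub>R D" using e by (simp add: ppath_def D_def)
    then have "frac t = 1 \<or> D = 0" by (simp only: add_left_cancel scaleR_cancel_right)
    then show False using neq[of "\<lfloor>t\<rfloor>"] frac_lt_1[of t] by (auto simp: D_def)
  qed
  obtain m d where d: "\<lfloor>t\<rfloor> = \<lfloor>s\<rfloor> + d + m * n" "d = 0 \<or> d = 1 \<and> x = V (\<lfloor>s\<rfloor> + 1) \<or> d = -1 \<and> x = V \<lfloor>s\<rfloor>"
    using E_meet[of x "\<lfloor>s\<rfloor>" "\<lfloor>t\<rfloor>"] ppath_in_E[of s] ppath_in_E[of t] eq unfolding x_def by metis
  have "d \<noteq> 1" using d ne[of s] by (auto simp: x_def)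
  moreover have "d \<noteq> -1"
  proof
    assume "d = -1"
    then have "V (\<lfloor>t\<rfloor> + 1) = x" using d V_shift[of "\<lfloor>s\<rfloor>" m] by simp
    then show False using ne[of t] eq x_def by simp
  qed
  ultimately have m: "\<lfloor>t\<rfloor> = \<lfloor>s\<rfloor> + m * n" using d by auto
  have b: "0 \<le> \<lfloor>s\<rfloor>" "\<lfloor>s\<rfloor> < n" "0 \<le> \<lfloor>t\<rfloor>" "\<lfloor>t\<rfloor> < n" using assms by (auto simp: floor_less_iff)
  have fl: "\<lfloor>t\<rfloor> = \<lfloor>s\<rfloor>"
  proof -
    have "\<lfloor>t\<rfloor> = \<lfloor>t\<rfloor> mod n" using b by simp
    also have "\<dots> = \<lfloor>s\<rfloor> mod n" using m by simp
    finally show ?thesis using b by simp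
  qed
  then have "frac s *\<^sub>R (V (\<lfloor>s\<rfloor> + 1) - V \<lfloor>s\<rfloor>) = frac t *\<^sub>R (V (\<lfloor>s\<rfloor> + 1) - V \<lfloor>s\<rfloor>)"
    using eq by (simp add: ppath_def)
  then have "frac s = frac t" using neq[of "\<lfloor>s\<rfloor>"] by auto
  then show ?thesis using fl by (simp add: frac_def)
qed

lemma continuous_on_ppath: "continuous_on {0..of_int n} (ppath V)"
proof -
  have "continuous_on (\<Union>k\<in>{0..<n}. {of_int k..of_int k + 1}) (ppath V)"
  proof (rule continuous_on_closed_Union)
    fix k assume "k \<in> {0..<n}"
    have "continuous_on {of_int k..of_int k + 1} (\<lambda>t. V k + (t - of_int k) *\<^sub>R (V (k + 1) - V k))"
      by (intro continuous_intros)
    then show "continuous_on {of_int k..of_int k + 1} (ppath V)"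
      by (rule continuous_on_eq) (simp add: ppath_on[of k])
  qed auto
  moreover have "{0..of_int n} \<subseteq> (\<Union>k\<in>{0..<n}. {of_int k..of_int k + 1 :: real})"
  proof
    fix t :: real assume t: "t \<in> {0..of_int n}"
    show "t \<in> (\<Union>k\<in>{0..<n}. {of_int k..of_int k + 1 :: real})"
    proof (cases "t = of_int n")
      case True
      then show ?thesis using n3 by (intro UN_I[of "n - 1"]) auto
    next
      case False
      then show ?thesis using t by (intro UN_I[of "\<lfloor>t\<rfloor>"]) (auto simp: floor_less_iff)
    qed
  qed
  ultimately show ?thesis by (rule continuous_on_subset)
qed

lemma K_circle: "K homeomorphic sphere (0::complex) 1"
proof -
  define \<gamma> where "\<gamma> t = ppath V (of_int n * t)" for t
  have n0: "0 < real_of_int n" using n3 by simp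
  have ends: "ppath V 0 = V 0" "ppath V (of_int n) = V 0"
    using per[of 0] by (auto simp: ppath_def)
  have cont: "continuous_on {0..1} \<gamma>"
    unfolding \<gamma>_def using n0
    by (intro continuous_on_compose2[OF continuous_on_ppath] continuous_intros) (auto simp: mult_left_le)
  have inj: "s = t" if "0 \<le> s" "s < 1" "0 \<le> t" "t < 1" "\<gamma> s = \<gamma> t" for s t
    using ppath_inj[of "of_int n * s" "of_int n * t"] that n0 by (auto simp: \<gamma>_def)
  have \<gamma>1: "\<gamma> 1 = \<gamma> 0" using ends by (simp add: \<gamma>_def)
  have "simple_path \<gamma>"
    unfolding simple_path_def path_def loop_free_def
  proof (intro conjI ballI impI cont)
    fix s t assume s: "s \<in> {0..1}" and t: "t \<in> {0..1}" and eq: "\<gamma> s = \<gamma> t"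
    show "s = t \<or> s = 0 \<and> t = 1 \<or> s = 1 \<and> t = 0"
    proof (cases "s = 1")
      case True
      then have "t = 1 \<or> 0 = t" using inj[of 0 t] t eq \<gamma>1 by fastforce
      then show ?thesis using True by auto
    next
      case False
      then show ?thesis using inj[of s t] inj[of s 0] s t eq \<gamma>1 by fastforce
    qed
  qed
  moreover have "pathfinish \<gamma> = pathstart \<gamma>" using \<gamma>1 by (simp add: pathfinish_def pathstart_def)
  moreover have "path_image \<gamma> = K"
  proof
    show "path_image \<gamma> \<subseteq> K"
      using ppath_in_E E_subset_K by (auto simp: path_image_def \<gamma>_def)
    show "K \<subseteq> path_image \<gamma>"
    proof
      fix x assume "x \<in> K"
      then obtain k where k: "k \<in> {0..<n}" "x \<in> E k" by (auto simp: K_eq)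
      then obtain u where u: "0 \<le> u" "u \<le> 1" "x = (1 - u) *\<^sub>R V k + u *\<^sub>R V (k + 1)"
        by (auto simp: seg_def in_segment)
      have "ppath V (of_int k + u) = V k + u *\<^sub>R (V (k + 1) - V k)"
        using ppath_on[of k "of_int k + u" V] u(1,2) by simp
      also have "\<dots> = x" unfolding u(3) by (simp add: algebra_simps)
      finally have "x = ppath V (of_int k + u)" ..
      then have "x = \<gamma> ((of_int k + u) / of_int n)" using n0 by (simp add: \<gamma>_def)
      moreover have "of_int k + 1 \<le> real_of_int n" using k by auto
      then have "(of_int k + u) / of_int n \<in> {0..1}" using k u n0 by auto
      ultimately show "x \<in> path_image \<gamma>" by (auto simp: path_image_def)
    qed
  qed
  ultimately show ?thesis using homeomorphic_simple_path_image_circle[of \<gamma> 1 0] by simp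
qed

lemma embedded: "embedded_solid_torus_with_core T K"
proof -
  obtain F G where FG: "homeomorphism T (K \<times> cball (0::complex) 1) F G" and core: "F ` K = K \<times> {0}"
    using solid_torus by blast
  obtain \<phi> \<psi> where h: "homeomorphism K (sphere (0::complex) 1) \<psi> \<phi>"
    using K_circle unfolding homeomorphic_def by blast
  have \<phi>: "continuous_on (sphere 0 1) \<phi>" "continuous_on K \<psi>" "\<phi> ` sphere 0 1 = K" "\<psi> ` K = sphere 0 1"
    "\<And>x. x \<in> K \<Longrightarrow> \<phi> (\<psi> x) = x" "\<And>z. z \<in> sphere 0 1 \<Longrightarrow> \<psi> (\<phi> z) = z"
    using h by (auto simp: homeomorphism_def)
  have prod: "homeomorphism (sphere 0 1 \<times> cball (0::complex) 1) (K \<times> cball 0 1)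
      (map_prod \<phi> id) (map_prod \<psi> id)"
    unfolding homeomorphism_def
  proof (intro conjI ballI)
    show "map_prod \<phi> id ` (sphere 0 1 \<times> cball (0::complex) 1) = K \<times> cball 0 1"
      "map_prod \<psi> id ` (K \<times> cball (0::complex) 1) = sphere 0 1 \<times> cball 0 1"
      using \<phi> by (simp_all add: map_prod_surj_on)
    show "continuous_on (sphere 0 1 \<times> cball (0::complex) 1) (map_prod \<phi> id)"
      "continuous_on (K \<times> cball (0::complex) 1) (map_prod \<psi> id)"
      unfolding map_prod_def case_prod_unfold id_def
      by (auto intro!: continuous_intros continuous_on_compose2[OF \<phi>(1)] continuous_on_compose2[OF \<phi>(2)])
  qed (use \<phi> in auto)
  have GF: "homeomorphism (K \<times> cball (0::complex) 1) T G F" using FG by (rule homeomorphism_symD)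
  have "homeomorphism (sphere 0 1 \<times> cball (0::complex) 1) T (G \<circ> map_prod \<phi> id) (map_prod \<psi> id \<circ> F)"
    using homeomorphism_compose[OF prod GF] .
  moreover have "(G \<circ> map_prod \<phi> id) ` (sphere 0 1 \<times> {0}) = K"
  proof -
    have "map_prod \<phi> id ` (sphere 0 1 \<times> {0::complex}) = K \<times> {0}"
      using \<phi>(3) by (simp add: map_prod_surj_on)
    then have "(G \<circ> map_prod \<phi> id) ` (sphere 0 1 \<times> {0}) = G ` F ` K" by (metis core image_comp)
    also have "\<dots> = K"
    proof -
      have "G (F x) = x" if "x \<in> K" for x using FG proj_K[OF that] by (simp add: homeomorphism_def)
      then show ?thesis by force
    qed
    finally show ?thesis .
  qed
  ultimately show ?thesis unfolding embedded_solid_torus_with_core_def by blast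
qed

end

section \<open>Translation from the indexed vertices\<close>

text \<open>Each difference is the component of one unit vector orthogonal to the other, divided by
  \<open>1 + a \<bullet> b\<close>. That is sine over one plus cosine of the angle, the tangent of
  the half angle.\<close>

lemma wall_angle:
  fixes a b :: "'a::real_inner"
  assumes ab: "norm a = 1" "norm b = 1" and c: "- 1 < a \<bullet> b"
  shows "norm ((a + b) /\<^sub>R (1 + a \<bullet> b) - b) = tan (arccos (a \<bullet> b) / 2)"
    and "norm ((a + b) /\<^sub>R (1 + a \<bullet> b) - a) = tan (arccos (a \<bullet> b) / 2)"
proof -
  have c1: "a \<bullet> b \<le> 1" using norm_cauchy_schwarz[of a b] ab by simp
  have t: "tan (arccos (a \<bullet> b) / 2) = sqrt (1 - (a \<bullet> b)\<^sup>2) / (1 + a \<bullet> b)"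
    using tan_half[of "arccos (a \<bullet> b) / 2"] sin_arccos[of "a \<bullet> b"] c c1 by (simp add: add.commute)
  have gen: "norm ((x + y) /\<^sub>R (1 + x \<bullet> y) - y) = sqrt (1 - (x \<bullet> y)\<^sup>2) / (1 + x \<bullet> y)"
    if "norm x = 1" "norm y = 1" "- 1 < x \<bullet> y" for x y :: 'a
  proof -
    have 1: "x \<bullet> x = 1" "y \<bullet> y = 1" using that by (auto simp: norm_eq_1)
    have "(x + y) /\<^sub>R (1 + x \<bullet> y) - y = (x + y - (1 + x \<bullet> y) *\<^sub>R y) /\<^sub>R (1 + x \<bullet> y)"
      using that by (simp add: scaleR_right_diff_distrib)
    also have "x + y - (1 + x \<bullet> y) *\<^sub>R y = x - (x \<bullet> y) *\<^sub>R y"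
      by (simp add: scaleR_left_distrib)
    finally have "norm ((x + y) /\<^sub>R (1 + x \<bullet> y) - y) = norm (x - (x \<bullet> y) *\<^sub>R y) / (1 + x \<bullet> y)"
      using that by (simp add: divide_inverse mult.commute)
    moreover have "norm (x - (x \<bullet> y) *\<^sub>R y) = sqrt (1 - (x \<bullet> y)\<^sup>2)"
      unfolding norm_eq_sqrt_inner
      by (simp add: inner_diff_left inner_diff_right 1 inner_commute power2_eq_square)
    ultimately show ?thesis by simp
  qed
  show "norm ((a + b) /\<^sub>R (1 + a \<bullet> b) - b) = tan (arccos (a \<bullet> b) / 2)"
    using gen[OF ab c] t by simp
  show "norm ((a + b) /\<^sub>R (1 + a \<bullet> b) - a) = tan (arccos (a \<bullet> b) / 2)"
    using gen[OF ab(2,1)] c t by (simp add: inner_commute add.commute)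
qed

definition cyc :: "(nat \<Rightarrow> pt) \<Rightarrow> nat \<Rightarrow> int \<Rightarrow> pt" where
  "cyc v n k = v (nat (k mod int n))"

lemma vtx_cyc: "vtx v n i = cyc v n (int i)"
  by (simp add: vtx_def cyc_def nat_mod_as_int)

lemma cyc_cong: "i mod int n = j mod int n \<Longrightarrow> cyc v n i = cyc v n j"
  by (simp add: cyc_def)

lemma cyc_cong_Suc:
  assumes "int i mod int n = k mod int n"
  shows "cyc v n (int (Suc i)) = cyc v n (k + 1)"
proof (rule cyc_cong)
  have "int (Suc i) = int i + 1" by simp
  then show "int (Suc i) mod int n = (k + 1) mod int n"
    using mod_add_cong[OF assms refl, of 1] by (simp only:)
qed

lemma edge_cyc:
  assumes "int i mod int n = k mod int n"
  shows "edge v n i = seg (cyc v n) k" "edge_len v n i = len (cyc v n) k"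
proof -
  have "cyc v n (int i) = cyc v n k" "cyc v n (int (Suc i)) = cyc v n (k + 1)"
    using cyc_cong[OF assms] cyc_cong_Suc[OF assms] by blast+
  then show "edge v n i = seg (cyc v n) k" "edge_len v n i = len (cyc v n) k"
    by (simp_all add: edge_def seg_def edge_len_def len_def vtx_cyc)
qed

lemma knot_path_cyc:
  assumes "0 < n"
  shows "knot_path v n t = ppath (cyc v n) t"
proof -
  have m: "int (nat (\<lfloor>t\<rfloor> mod int n)) mod int n = \<lfloor>t\<rfloor> mod int n" using assms by simp
  have "(1 - s) *\<^sub>R a + s *\<^sub>R b = a + s *\<^sub>R (b - a)" for s and a b :: pt by (simp add: algebra_simps)
  then show ?thesis
    unfolding knot_path_def Let_def vtx_cyc cyc_cong[OF m] cyc_cong_Suc[OF m] ppath_def frac_def .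
qed

lemma turning_angle_cyc:
  fixes v n k
  defines "V \<equiv> cyc v n" and "i \<equiv> nat (k mod int n)"
  assumes n: "0 < n" and neq: "\<And>k. V k \<noteq> V (k + 1)"
  shows "turning_angle v n i = arccos (dir V (k - 1) \<bullet> dir V k)"
    and "edge_len v n (i + n - 1) = len V (k - 1)" and "edge_len v n i = len V k"
proof -
  have i: "int i mod int n = k mod int n" using n by (simp add: i_def)
  \<comment> \<open>Adding \<open>n\<close> first avoids truncated subtraction at
    \<open>i = 0\<close>.\<close>
  have i1: "int (i + n - 1) mod int n = (k - 1) mod int n"
  proof -
    have "int (i + n - 1) = int i - 1 + int n" using n by (simp add: of_nat_diff)
    then show ?thesis using i by (metis mod_add_self2 mod_diff_left_eq)
  qed
  show "edge_len v n (i + n - 1) = len V (k - 1)" "edge_len v n i = len V k"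
    using edge_cyc(2)[OF i] edge_cyc(2)[OF i1] by (simp_all add: V_def)
  have vt: "vtx v n i = V k" "vtx v n (i + n - 1) = V (k - 1)" "vtx v n (Suc i) = V (k + 1)"
    unfolding V_def vtx_cyc by (rule cyc_cong[OF i] cyc_cong[OF i1] cyc_cong_Suc[OF i])+
  have "0 < norm (V k - V (k - 1))" "0 < norm (V (k + 1) - V k)"
    using neq[of k] neq[of "k - 1"] by auto
  then show "turning_angle v n i = arccos (dir V (k - 1) \<bullet> dir V k)"
    unfolding turning_angle_def Let_def vt
    by (simp add: dir_def sgn_div_norm divide_inverse mult_ac)
qed

lemma knot_set_cyc:
  assumes "0 < n"
  shows "knot_set v n = (\<Union>k. seg (cyc v n) k)"
proof
  show "knot_set v n \<subseteq> (\<Union>k. seg (cyc v n) k)"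
    using edge_cyc(1)[OF refl] by (auto simp: knot_set_def)
  show "(\<Union>k. seg (cyc v n) k) \<subseteq> knot_set v n"
  proof
    fix x assume "x \<in> (\<Union>k. seg (cyc v n) k)"
    then obtain k where "x \<in> seg (cyc v n) k" by blast
    then have "x \<in> edge v n (nat (k mod int n))" using edge_cyc(1)[of "nat (k mod int n)" n k] assms by simp
    then show "x \<in> knot_set v n" using assms by (force simp: knot_set_def nat_less_iff)
  qed
qed

lemma thick_polygonI:
  assumes knot: "polygonal_knot v n" and r: "0 < r" "ereal r < thickness_radius v n"
  shows "thick_polygon (cyc v n) (int n) r"
proof -
  define V where "V = cyc v n"
  have n: "3 \<le> n" and inj: "inj_on v {..<n}"
    and inter: "\<And>i j. i < n \<Longrightarrow> j < n \<Longrightarrow> i \<noteq> j \<Longrightarrow> edge v n i \<inter> edge v n j =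
          (if j = Suc i mod n then {vtx v n (Suc i)}
           else if i = Suc j mod n then {vtx v n (Suc j)} else {})"
    using knot by (auto simp: polygonal_knot_def)
  define c where "c k = nat (k mod int n)" for k
  have c_less: "c k < n" for k using n by (simp add: c_def nat_less_iff)
  have c_mod: "int (c k) mod int n = k mod int n" for k using n by (simp add: c_def)
  have c_eq: "c i = c j \<longleftrightarrow> int n dvd i - j" for i j
    using n by (simp add: c_def mod_eq_dvd_iff[symmetric] eq_nat_nat_iff)
  have c_Suc: "Suc (c k) mod n = c (k + 1)" for k
  proof -
    have "int (Suc (c k) mod n) = (int (c k) + 1) mod int n" by (simp add: zmod_int add.commute)
    also have "\<dots> = (k + 1) mod int n" using n by (simp add: c_def mod_add_left_eq)
    also have "\<dots> = int (c (k + 1))" using n by (simp add: c_def)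
    finally show ?thesis by simp
  qed
  have edge: "edge v n (c k) = seg V k" for k using edge_cyc(1)[OF c_mod] by (simp add: V_def)
  have vt: "vtx v n (Suc (c k)) = V (k + 1)" for k
    unfolding V_def vtx_cyc by (rule cyc_cong_Suc[OF c_mod])
  have not_dvd: "\<not> int n dvd 1" using n by simp
  have neq: "V k \<noteq> V (k + 1)" for k
  proof
    assume "V k = V (k + 1)"
    then have "c k = c (k + 1)" using inj_onD[OF inj, of "c k" "c (k + 1)"] c_less by (simp add: V_def cyc_def c_def)
    then show False using not_dvd by (simp add: c_eq)
  qed
  have thick: "r * norm (wall V k - dir V k) < min (len V (k - 1)) (len V k) / 2"
     "r * norm (wall V k - dir V (k - 1)) < min (len V (k - 1)) (len V k) / 2" for k
  proof -
    define u where "u = dir V (k - 1) \<bullet> dir V k"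
    define m where "m = min (len V (k - 1)) (len V k)"
    have m: "0 < m" using neq[of "k - 1"] neq[of k] by (simp add: m_def len_def)
    have nU: "norm (dir V j) = 1" for j using neq[of j] by (simp add: dir_def norm_sgn)
    have u: "- 1 \<le> u" "u \<le> 1"
      using Cauchy_Schwarz_ineq2[of "dir V (k - 1)" "dir V k"] by (auto simp: nU u_def)
    have "Rad v n (c k) = (if arccos u = 0 then \<infinity> else ereal (m / (2 * tan (arccos u / 2))))"
      unfolding Rad_def c_def m_def u_def
      using turning_angle_cyc[of n v k] n neq unfolding V_def by simp
    moreover have "ereal r < Rad v n (c k)"
    proof -
      have "ereal r < MinRad v n" using r by (simp add: thickness_radius_def)
      also have "\<dots> \<le> Rad v n (c k)" unfolding MinRad_def using c_less by (intro Min_le) auto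
      finally show ?thesis .
    qed
    ultimately have rad: "arccos u = 0 \<or> r < m / (2 * tan (arccos u / 2))" by (auto split: if_splits)
    \<comment> \<open>For \<open>u = - 1\<close> the angle is \<open>pi\<close>, and
      \<open>tan (pi / 2)\<close> has the default value 0; the quotient in \<open>rad\<close> is
      then 0, against \<open>0 < r\<close>.\<close>
    have "u \<noteq> - 1"
    proof
      assume "u = - 1"
      then show False using rad r by simp
    qed
    then have u1: "- 1 < u" using u by simp
    have bound: "r * tan (arccos u / 2) < m / 2"
    proof (cases "arccos u = 0")
      case True
      then show ?thesis using m by simp
    next
      case False
      have "0 < arccos u" using False arccos_lbound[of u] u by simp
      moreover have "arccos u < pi"
        using u1 u arccos_less_arccos[of "-1" u] by simp
      ultimately have "0 < tan (arccos u / 2)" by (intro tan_gt_zero) auto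
      then show ?thesis using rad False by (simp add: field_simps)
    qed
    have "wall V k = (dir V (k - 1) + dir V k) /\<^sub>R (1 + dir V (k - 1) \<bullet> dir V k)" by (simp add: wall_def)
    then show "r * norm (wall V k - dir V k) < min (len V (k - 1)) (len V k) / 2"
     "r * norm (wall V k - dir V (k - 1)) < min (len V (k - 1)) (len V k) / 2"
      using wall_angle[OF nU nU, of "k - 1" k] u1 bound by (simp_all add: u_def m_def)
  qed
  have K: "knot_set v n = (\<Union>k. seg V k)" using knot_set_cyc n by (simp add: V_def)
  have locmin_K: "x \<in> knot_set v n" if "locmin V y x" for x y
    using that unfolding locmin_def K seg_def by (auto simp: open_segment_def intro: ends_in_segment)
  have turn: "turning_point v n y x" if "locmin V y x" for x y
    using locmin_turning[OF neq that] n
    unfolding turning_point_def Let_def knot_path_cyc[of n v, OF order_less_le_trans[OF zero_less_numeral n]]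
    unfolding V_def[symmetric] by blast
  have dc: "2 * r < dist x y" if "locmin V x y" "locmin V y x" "x \<noteq> y" for x y
  proof (rule ccontr)
    assume "\<not> 2 * r < dist x y"
    have "(x, y) \<in> DC v n" using that locmin_K turn by (auto simp: DC_def)
    then have "dcsd v n \<le> ereal (dist x y)" unfolding dcsd_def by (intro Inf_lower) force
    also have "\<dots> \<le> ereal (2 * r)" using \<open>\<not> 2 * r < dist x y\<close> by simp
    finally have "dcsd v n / 2 \<le> ereal (2 * r) / 2" by (intro ereal_divide_right_mono) auto
    then have "dcsd v n / 2 \<le> ereal r" by simp
    moreover have "ereal r < dcsd v n / 2" using r(2) by (simp only: thickness_radius_def min_less_iff_conj)
    ultimately show False using leD by blast
  qed
  have "thick_polygon V (int n) r"
  proof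
    show "3 \<le> int n" using n by simp
    show "V (k + int n) = V k" for k by (simp add: V_def cyc_def)
    show "V k \<noteq> V (k + 1)" for k by (rule neq)
    show "seg V k \<inter> seg V (k + 1) = {V (k + 1)}" for k
      using inter[of "c k" "c (k + 1)"] c_less not_dvd by (simp add: c_eq c_Suc edge vt)
    show "seg V i \<inter> seg V j = {}" if "\<not> adj (int n) i j" for i j
    proof -
      have "\<not> int n dvd i - j" "\<not> int n dvd i - (j + 1)" "\<not> int n dvd j - (i + 1)"
        using that dvd_minus_iff[of "int n" "i - j + 1"] by (auto simp: adj_def algebra_simps)
      then have "c i \<noteq> c j" "c i \<noteq> Suc (c j) mod n" "c j \<noteq> Suc (c i) mod n"
        by (simp_all add: c_Suc c_eq)
      then show ?thesis using inter[of "c i" "c j"] c_less by (simp add: edge)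
    qed
    show "0 < r" by fact
    show "r * norm (wall V k - dir V k) < len V k / 2" "r * norm (wall V k - dir V (k - 1)) < len V (k - 1) / 2"
      "r * norm (wall V k - dir V k) < len V (k - 1) / 2" "r * norm (wall V k - dir V (k - 1)) < len V k / 2" for k
      using thick[of k] by auto
    show "2 * r < dist x y" if "locmin V x y" "locmin V y x" "x \<noteq> y" for x y using dc that .
  qed
  then show ?thesis by (simp add: V_def)
qed

theorem theorem7p1:
  fixes v :: "nat \<Rightarrow> real^3" and n :: nat and r :: real
  assumes "polygonal_knot v n"
    and "0 < r"
    and "ereal r < thickness_radius v n"
  shows "embedded_solid_torus_with_core (Tube v n r) (knot_set v n)"
proof -
  interpret thick_polygon "cyc v n" "int n" r
    using assms by (rule thick_polygonI)
  have K: "knot_set v n = K"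
    using knot_set_cyc n3 by (simp add: K_def)
  \<comment> \<open>The knot is compact, so nearest points exist and the union of balls is a closed
    neighbourhood in terms of \<open>infdist\<close>.\<close>
  have "Tube v n r = {p. infdist p (knot_set v n) \<le> r}"
  proof -
    have "(\<exists>x\<in>knot_set v n. dist p x \<le> r) \<longleftrightarrow> infdist p (knot_set v n) \<le> r" for p
    proof -
      obtain x where "x \<in> K" "infdist p K = dist p x"
        using infdist_attains_inf[OF compact_imp_closed[OF compact_K] K_nonempty] .
      then show ?thesis using infdist_le2[of _ K p r] by (auto simp: K)
    qed
    moreover have "Tube v n r = {p. \<exists>x\<in>knot_set v n. dist p x \<le> r}"
      unfolding Tube_def Tube_edge_def knot_set_def by (auto simp: dist_commute; blast)
    ultimately show ?thesis by simp
  qed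
  also have "\<dots> = T" using T_iff by (auto simp: K)
  finally show ?thesis using embedded by (simp add: K)
qed

end
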